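(* Let $p$ be a monotone decreasing probability mass function on $\mathbb N$, written in terms of its intervals of constancy: $p_x=\theta_i$ if $x\in C_i$, where $\theta_i>\theta_{i+1}$ for all $i=1,2,\dots$, all $\theta_i>0$, and $\{C_i\}_{i\ge1}$ (a finite or infinite collection) forms a partition of the support $\{x\in\mathbb N:p_x>0\}$. Then $$E\left[\sum_{x\ge0}(Y_x^G)^2\right]=\sum_{i\ge1}\sum_{j=1}^{|C_i|}\theta_i\left(\frac1j-\theta_i\right).$$ Also, if $\kappa=\sup\{x:p_x>0\}<\infty$, then $$E\left[\sum_{x=0}^\kappa\frac{(Y_x^G)^2}{p_x}\right]=\sum_{i\ge1}\sum_{j=1}^{|C_i|}\left(\frac1j-\theta_i\right).$$
   Context: $\mathbb N=\{0,1,2,\dots\}$. $p$ is monotone decreasing if $p_x\ge p_{x+1}$ for all $x\in\mathbb N$. For a finite vector $w=(w_r,\dots,w_s)$, $\mathrm{gren}(w)$ is the vector, indexed by $j=r,\dots,s$, of left slopes at $j$ of the least concave majorant of the points $\{(j,\sum_{i=r}^jw_i):j=r-1,r,\dots,s\}$ (empty sum $=0$). $Y=(Y_x)_{x\in\mathbb N}$ is the mean-zero Gaussian process in $\ell_2$ with $\mathrm{cov}(Y_x,Y_{x'})=p_x\delta_{x,x'}-p_xp_{x'}$. $Y^G$ is obtained from $Y$ by setting $(Y^G_r,\dots,Y^G_s)=\mathrm{gren}(Y_r,\dots,Y_s)$ for all $r<s$ with $p_{r-1}>p_r=\dots=p_s>p_{s+1}$ (convention $p_{-1}=+\infty$), and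 $Y^G_x=Y_x$ for all other $x$ (so $Y^G_x=0$ a.s. when $p_x=0$). *)

theory Defs
  imports "HOL-Probability.Probability"
begin

text \<open>The normal law with mean \<open>m\<close> and standard deviation \<open>\<sigma> \<ge> 0\<close>; the degenerate case
  \<open>\<sigma> = 0\<close> is the point mass at \<open>m\<close>.\<close>

definition normal_law :: "real \<Rightarrow> real \<Rightarrow> real measure" where
  "normal_law m \<sigma> =
     (if \<sigma> = 0 then return borel m
      else density lborel (\<lambda>x. ennreal (normal_density m \<sigma> x)))"

text \<open>Degenerate normal laws have to be admitted because the covariance kernel of interest may be
  singular.\<close>

definition gaussian_process :: "'a measure \<Rightarrow> (nat \<Rightarrow> 'a \<Rightarrow> real) \<Rightarrow> bool" where
  "gaussian_process M Y \<longleftrightarrow>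
     (\<forall>x. Y x \<in> borel_measurable M) \<and>
     (\<forall>F (a :: nat \<Rightarrow> real). finite F \<longrightarrow>
        (\<exists>m \<sigma>. 0 \<le> \<sigma> \<and> distr M borel (\<lambda>\<omega>. \<Sum>x\<in>F. a x * Y x \<omega>) = normal_law m \<sigma>))"

definition covariance :: "'a measure \<Rightarrow> ('a \<Rightarrow> real) \<Rightarrow> ('a \<Rightarrow> real) \<Rightarrow> real" where
  "covariance M X Z =
     (\<integral>\<omega>. (X \<omega> - (\<integral>\<omega>'. X \<omega>' \<partial>M)) * (Z \<omega> - (\<integral>\<omega>'. Z \<omega>' \<partial>M)) \<partial>M)"

definition centered_gaussian_process_l2 ::
  "'a measure \<Rightarrow> (nat \<Rightarrow> 'a \<Rightarrow> real) \<Rightarrow> (nat \<Rightarrow> nat \<Rightarrow> real) \<Rightarrow> bool" where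
  "centered_gaussian_process_l2 M Y K \<longleftrightarrow>
     gaussian_process M Y \<and>
     (AE \<omega> in M. summable (\<lambda>x. (Y x \<omega>)\<^sup>2)) \<and>
     (\<forall>x. (\<integral>\<omega>. Y x \<omega> \<partial>M) = 0) \<and>
     (\<forall>x x'. covariance M (Y x) (Y x') = K x x')"

text \<open>The least concave majorant on the convex set \<open>A\<close> of a set \<open>P\<close> of points in the plane. The
  infimum is meaningful for \<open>t \<in> A\<close> when \<open>A\<close> is the convex hull of the finite nonempty set of
  abscissae of \<open>P\<close>.\<close>

definition least_concave_majorant :: "real set \<Rightarrow> (real \<times> real) set \<Rightarrow> real \<Rightarrow> real" where
  "least_concave_majorant A P t =
     (INF g\<in>{g. concave_on A g \<and> (\<forall>(u, v)\<in>P. v \<le> g u)}. g t)"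

definition left_slope :: "(real \<Rightarrow> real) \<Rightarrow> real \<Rightarrow> real" where
  "left_slope f t = Lim (at_left t) (\<lambda>u. (f t - f u) / (t - u))"

text \<open>The points \<open>(j, w\<^sub>r + \<dots> + w\<^sub>j)\<close>, \<open>j = r-1, \<dots>, s\<close>, are enumerated by \<open>k = j + 1\<close>, so that the
  abscissa \<open>-1\<close>, which occurs for \<open>r = 0\<close>, is not truncated.\<close>

definition gren :: "nat \<Rightarrow> nat \<Rightarrow> (nat \<Rightarrow> real) \<Rightarrow> nat \<Rightarrow> real" where
  "gren r s w j =
     left_slope
       (least_concave_majorant {real r - 1..real s}
          ((\<lambda>k. (real k - 1, \<Sum>i\<in>{r..<k}. w i)) ` {r..Suc s}))
       (real j)"

text \<open>The disjunct \<open>r = 0\<close> is the convention \<open>p\<^sub>-\<^sub>1 = \<infinity>\<close>.\<close>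

definition flat_stretch :: "(nat \<Rightarrow> real) \<Rightarrow> nat \<Rightarrow> nat \<Rightarrow> bool" where
  "flat_stretch p r s \<longleftrightarrow>
     r < s \<and> (r = 0 \<or> p (r - 1) > p r) \<and> (\<forall>x\<in>{r..s}. p x = p r) \<and> p s > p (s + 1)"

text \<open>Two flat stretches with a common point are equal, so \<open>THE\<close> is well defined here.\<close>

definition gren_on_stretches :: "(nat \<Rightarrow> real) \<Rightarrow> (nat \<Rightarrow> real) \<Rightarrow> nat \<Rightarrow> real" where
  "gren_on_stretches p y x =
     (if \<exists>r s. flat_stretch p r s \<and> x \<in> {r..s}
      then let (r, s) = (THE (r, s). flat_stretch p r s \<and> x \<in> {r..s}) in gren r s y x
      else y x)"

end

theory Submission
  imports Defs
begin

text \<open>For a real vector \<open>w\<close> with partial sums \<open>S\<^sub>k\<close> the entries \<open>g\<^sub>j\<close> of its Grenander vector decrease, and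
  \<open>\<Sum>\<^sub>j (g\<^sub>j - a)\<^sup>+ = max\<^sub>k (S\<^sub>k - a k)\<close> for every real \<open>a\<close>. If \<open>w\<close> is random and exchangeable, Spitzer's identity
  evaluates the mean of the right-hand side as \<open>\<Sum>\<^sub>k E (S\<^sub>k - a k)\<^sup>+ / k\<close>. Integrating over \<open>2 da\<close> on the half line
  \<open>a \<ge> 0\<close>, and likewise for the negative parts, gives \<open>E \<Sum>\<^sub>j g\<^sub>j\<^sup>2 = \<Sum>\<^sub>k E S\<^sub>k\<^sup>2 / k\<^sup>2\<close>. On a level set of \<open>p\<close> of
  height \<open>\<theta>\<close> the process is exchangeable with \<open>E S\<^sub>k\<^sup>2 = \<theta> k - \<theta>\<^sup>2 k\<^sup>2\<close>, so each level set contributes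
  \<open>\<Sum>\<^sub>k \<theta> (1/k - \<theta>)\<close>.\<close>

section \<open>Least concave majorants of equally spaced points\<close>

text \<open>Two features of the problem shape the argument. The entries on a level set are
  negatively correlated, with covariance -\<theta>^2, so Spitzer's identity in its usual form for
  independent summands is out of reach; the recursion behind it needs only invariance under
  permutations. Moreover the covariance matrix may be singular (over a finite support the entries of
  \<open>Y\<close> sum to zero almost surely), so there need not be a joint density to permute:
  exchangeability is read off the laws of linear combinations, which are normal with a variance
  fixed by the kernel. Spitzer's identity yields only first moments of maxima. Second moments become
  accessible because subtracting the same \<open>a\<close> from each variable preserves
  exchangeability, so that the identity holds at every level \<open>a\<close> and can be integrated.
  The negative parts do not follow by passing to -w, since the majorant of -S is not minus the
  majorant of S. Instead (-x - a)^+ = (x + a)^+ - (x + a), together with the slopes summing to S_n,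
  reduces them to positive parts at level -a.\<close>

context
  fixes c :: real and n :: nat and S :: "nat \<Rightarrow> real"
begin

private abbreviation "hull_ivl \<equiv> {c..c + real n}"

private abbreviation "majorants \<equiv> {g. concave_on hull_ivl g \<and> (\<forall>k\<le>n. S k \<le> g (c + real k))}"

text \<open>The offset \<open>c\<close> is real and the points are numbered from 0. In the
  application \<open>c\<close> is r - 1, which is negative for r = 0.\<close>

definition majorant :: "real \<Rightarrow> real" where
  "majorant = least_concave_majorant hull_ivl ((\<lambda>k. (c + real k, S k)) ` {..n})"

text \<open>This is the increment over the cell between the points numbered \<open>j\<close> and
  \<open>Suc j\<close>, so it will be the left slope at \<open>c + real (Suc j)\<close>.\<close>

definition majorant_slope :: "nat \<Rightarrow> real" where
  "majorant_slope j = majorant (c + real (Suc j)) - majorant (c + real j)"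

lemma majorant_eq_INF: "majorant t = (INF g\<in>majorants. g t)"
proof -
  have "{g. concave_on hull_ivl g \<and> (\<forall>(u, v)\<in>(\<lambda>k. (c + real k, S k)) ` {..n}. v \<le> g u)} = majorants"
    by auto
  then show ?thesis
    unfolding majorant_def least_concave_majorant_def by simp
qed

lemma affine_in_majorants:
  assumes "\<And>k. k \<le> n \<Longrightarrow> S k \<le> a * real k + b"
  shows "(\<lambda>t. a * (t - c) + b) \<in> majorants"
proof -
  have "u * (a * (x - c) + b) + v * (a * (y - c) + b) = a * (u * x + v * y - c) + b"
    if "u + v = 1" for x y u v :: real
  proof -
    have v: "v = 1 - u" using that by simp
    show ?thesis unfolding v by (simp add: algebra_simps)
  qed
  then have "concave_on hull_ivl (\<lambda>t. a * (t - c) + b)"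
    unfolding concave_on_iff by auto
  then show ?thesis using assms by auto
qed

lemma majorants_nonempty: "majorants \<noteq> {}"
proof -
  have "(\<lambda>t. 0 * (t - c) + Max (S ` {..n})) \<in> majorants"
    by (rule affine_in_majorants) auto
  then show ?thesis by blast
qed

text \<open>A concave function lies above its chord over the whole interval, and the chord of any
  majorant lies above the one from \<open>S 0\<close> to \<open>S n\<close>. This bound does not
  depend on the majorant, which makes the real infimum meaningful.\<close>

lemma majorants_bdd_below:
  assumes "t \<in> hull_ivl"
  shows "bdd_below ((\<lambda>g. g t) ` majorants)"
proof -
  \<comment> \<open>For \<open>n = 0\<close> the quotient is 0 by the convention on division, and
    the interval is the single point \<open>c\<close>.\<close>
  define u where "u = (t - c) / real n"
  have u: "0 \<le> u" "u \<le> 1" and t: "(1 - u) *\<^sub>R c + u *\<^sub>R (c + real n) = t"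
    using assms by (cases "n = 0"; auto simp: u_def divide_simps algebra_simps)+
  have "(1 - u) * S 0 + u * S n \<le> g t" if g: "g \<in> majorants" for g
  proof -
    have "(1 - u) * g c + u * g (c + real n) \<le> g t"
      using concave_onD[of hull_ivl g u c "c + real n"] g u t by auto
    moreover have "S 0 \<le> g c" "S n \<le> g (c + real n)" using g by force+
    ultimately show ?thesis
      using u by (smt (verit, best) mult_left_mono)
  qed
  then show ?thesis by (auto intro!: bdd_belowI2)
qed

lemma majorant_le: "g \<in> majorants \<Longrightarrow> t \<in> hull_ivl \<Longrightarrow> majorant t \<le> g t"
  unfolding majorant_eq_INF by (rule cINF_lower[OF majorants_bdd_below])

lemma majorant_ge: "(\<And>g. g \<in> majorants \<Longrightarrow> b \<le> g t) \<Longrightarrow> b \<le> majorant t"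
  unfolding majorant_eq_INF using majorants_nonempty by (rule cINF_greatest)

lemma majorant_le_affine:
  assumes "\<And>k. k \<le> n \<Longrightarrow> S k \<le> a * real k + b" "t \<in> hull_ivl"
  shows "majorant t \<le> a * (t - c) + b"
  using majorant_le[OF affine_in_majorants[OF assms(1)] assms(2)] .

lemma le_majorant: "k \<le> n \<Longrightarrow> S k \<le> majorant (c + real k)"
  by (rule majorant_ge) auto

lemma concave_majorant: "concave_on hull_ivl majorant"
  unfolding concave_on_iff
proof (intro conjI ballI allI impI)
  fix x y u v :: real
  assume *: "x \<in> hull_ivl" "y \<in> hull_ivl" "0 \<le> u" "0 \<le> v" "u + v = 1"
  show "u * majorant x + v * majorant y \<le> majorant (u *\<^sub>R x + v *\<^sub>R y)"
  proof (rule majorant_ge)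
    fix g assume g: "g \<in> majorants"
    have "u * majorant x + v * majorant y \<le> u * g x + v * g y"
      using * g by (intro add_mono mult_left_mono majorant_le) auto
    also have "\<dots> \<le> g (u *\<^sub>R x + v *\<^sub>R y)"
      using g * unfolding concave_on_iff by blast
    finally show "u * majorant x + v * majorant y \<le> g (u *\<^sub>R x + v *\<^sub>R y)" .
  qed
qed simp

text \<open>A slope so steep that the line through either end point with slope \<open>spread\<close>
  or \<open>- spread\<close>, respectively, dominates all the points. These two lines pin the
  majorant at the ends, where concavity alone would permit a jump.\<close>

private definition "spread = (\<Sum>k\<le>n. \<bar>S k\<bar>) * 2"

lemma abs_diff_le_spread:
  assumes "i \<le> n" "j \<le> n"
  shows "\<bar>S i - S j\<bar> \<le> spread"
proof -
  have "\<bar>S l\<bar> \<le> (\<Sum>k\<le>n. \<bar>S k\<bar>)" if "l \<le> n" for l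
    using that by (intro member_le_sum[of l "{..n}" "\<lambda>k. \<bar>S k\<bar>"]) auto
  from this[OF assms(1)] this[OF assms(2)] show ?thesis
    unfolding spread_def by linarith
qed

lemma spread_nonneg: "0 \<le> spread"
  unfolding spread_def by (simp add: sum_nonneg)

lemma majorant_left: "majorant c = S 0"
proof (rule antisym)
  have "S k \<le> spread * real k + S 0" if "k \<le> n" for k
  proof (cases "k = 0")
    case False
    then have "spread \<le> spread * real k" using spread_nonneg by (simp add: mult_le_cancel_left1)
    then show ?thesis using abs_diff_le_spread[OF that, of 0] by simp
  qed simp
  from majorant_le_affine[OF this, of c] show "majorant c \<le> S 0" by simp
  show "S 0 \<le> majorant c" using le_majorant[of 0] by simp
qed

lemma majorant_right: "majorant (c + real n) = S n"
proof (rule antisym)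
  have "S k \<le> - spread * real k + (S n + spread * real n)" if "k \<le> n" for k
  proof (cases "k = n")
    case False
    then have "1 \<le> real n - real k" using that by linarith
    then have "spread * 1 \<le> spread * (real n - real k)" using spread_nonneg by (intro mult_left_mono)
    then show ?thesis using abs_diff_le_spread[OF that, of n] by (simp add: algebra_simps)
  qed (simp add: algebra_simps)
  from majorant_le_affine[OF this, of "c + real n"] show "majorant (c + real n) \<le> S n"
    by (simp add: algebra_simps)
  show "S n \<le> majorant (c + real n)" using le_majorant[of n] by simp
qed

lemma majorant_slope_Suc_le:
  assumes "Suc (Suc j) \<le> n"
  shows "majorant_slope (Suc j) \<le> majorant_slope j"
proof -
  have "(1 - 1/2) * majorant (c + real j) + 1/2 * majorant (c + real (Suc (Suc j)))
     \<le> majorant ((1 - 1/2) *\<^sub>R (c + real j) + (1/2) *\<^sub>R (c + real (Suc (Suc j))))"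
    using assms by (intro concave_onD[OF concave_majorant]) auto
  also have "(1 - 1/2) *\<^sub>R (c + real j) + (1/2) *\<^sub>R (c + real (Suc (Suc j))) = c + real (Suc j)"
    by (simp add: field_simps)
  finally show ?thesis by (simp add: majorant_slope_def)
qed

lemma majorant_slope_antimono:
  assumes "i \<le> j" "j < n"
  shows "majorant_slope j \<le> majorant_slope i"
  using assms
proof (induction j rule: dec_induct)
  case (step j)
  then show ?case using majorant_slope_Suc_le[of j] by simp
qed simp

lemma majorant_diff_eq_sum:
  assumes "i \<le> k"
  shows "majorant (c + real k) - majorant (c + real i) = (\<Sum>j\<in>{i..<k}. majorant_slope j)"
  unfolding majorant_slope_def using sum_Suc_diff'[OF assms, of "\<lambda>j. majorant (c + real j)"] by simp

lemma sum_majorant_slope: "(\<Sum>j<n. majorant_slope j) = S n - S 0"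
  using majorant_diff_eq_sum[of 0 n] by (simp add: majorant_left majorant_right atLeast0LessThan)

text \<open>Since the slopes decrease, the line prolonging the chord of one cell passes above the
  majorant at every grid point on both sides. It is therefore itself an affine majorant of the
  points, and the infimum lies below it on the whole interval.\<close>

lemma majorant_le_chord:
  assumes "j < n" "t \<in> hull_ivl"
  shows "majorant t \<le> majorant_slope j * (t - c) + (majorant (c + real j) - majorant_slope j * real j)"
proof (rule majorant_le_affine[OF _ assms(2)])
  fix k assume k: "k \<le> n"
  have "majorant (c + real k) \<le> majorant (c + real j) + majorant_slope j * (real k - real j)"
  proof (cases "j \<le> k")
    case True
    have "(\<Sum>i\<in>{j..<k}. majorant_slope i) \<le> (\<Sum>i\<in>{j..<k}. majorant_slope j)"
      using k by (intro sum_mono majorant_slope_antimono) auto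
    then show ?thesis using majorant_diff_eq_sum[OF True] True
      by (simp add: of_nat_diff algebra_simps)
  next
    case False
    have "(\<Sum>i\<in>{k..<j}. majorant_slope j) \<le> (\<Sum>i\<in>{k..<j}. majorant_slope i)"
      using assms(1) by (intro sum_mono majorant_slope_antimono) auto
    then show ?thesis using majorant_diff_eq_sum[of k j] False
      by (simp add: of_nat_diff algebra_simps)
  qed
  then show "S k \<le> majorant_slope j * real k + (majorant (c + real j) - majorant_slope j * real j)"
    using le_majorant[OF k] by (simp add: algebra_simps)
qed

text \<open>The prolonged chord bounds the majorant from above and concavity bounds it from below by
  the same chord. Affinity on each cell thus follows without locating the vertices where the
  majorant touches the points.\<close>

lemma majorant_eq_chord:
  assumes "j < n" "0 \<le> u" "u \<le> 1"
  shows "majorant (c + real j + u) = majorant (c + real j) + u * majorant_slope j"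
proof (rule antisym)
  have "c + real j + u \<in> hull_ivl" using assms by auto
  from majorant_le_chord[OF assms(1) this]
  show "majorant (c + real j + u) \<le> majorant (c + real j) + u * majorant_slope j"
    by (simp add: algebra_simps)
  have "(1 - u) * majorant (c + real j) + u * majorant (c + real (Suc j))
     \<le> majorant ((1 - u) *\<^sub>R (c + real j) + u *\<^sub>R (c + real (Suc j)))"
    using assms by (intro concave_onD[OF concave_majorant]) auto
  also have "(1 - u) *\<^sub>R (c + real j) + u *\<^sub>R (c + real (Suc j)) = c + real j + u"
    by (simp add: algebra_simps)
  finally show "majorant (c + real j) + u * majorant_slope j \<le> majorant (c + real j + u)"
    by (simp add: majorant_slope_def algebra_simps)
qed

text \<open>On the cell to the left the difference quotient is constant, so the limit in
  \<open>left_slope\<close> exists and equals that constant.\<close>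

lemma left_slope_majorant:
  assumes "j < n"
  shows "left_slope majorant (c + real (Suc j)) = majorant_slope j"
proof -
  have "(majorant (c + real (Suc j)) - majorant u) / (c + real (Suc j) - u) = majorant_slope j"
    if "u \<in> {c + real j <..< c + real (Suc j)}" for u
  proof -
    define v where "v = u - (c + real j)"
    have v: "0 < v" "v < 1" "u = c + real j + v" using that by (auto simp: v_def)
    have "majorant u = majorant (c + real j) + v * majorant_slope j"
      unfolding v(3) using v by (intro majorant_eq_chord[OF assms]) auto
    then have "majorant (c + real (Suc j)) - majorant u = (1 - v) * majorant_slope j"
      by (simp add: majorant_slope_def algebra_simps)
    moreover have "c + real (Suc j) - u = 1 - v" by (simp add: v(3))
    ultimately show ?thesis using v by simp
  qed
  moreover have "eventually (\<lambda>u. u \<in> {c + real j <..< c + real (Suc j)}) (at_left (c + real (Suc j)))"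
    by (rule eventually_at_left_real) simp
  ultimately have "eventually (\<lambda>u. (majorant (c + real (Suc j)) - majorant u) / (c + real (Suc j) - u)
      = majorant_slope j) (at_left (c + real (Suc j)))"
    by (auto elim: eventually_mono)
  then have "((\<lambda>u. (majorant (c + real (Suc j)) - majorant u) / (c + real (Suc j) - u))
      \<longlongrightarrow> majorant_slope j) (at_left (c + real (Suc j)))"
    by (rule tendsto_eventually)
  then show ?thesis unfolding left_slope_def by (intro tendsto_Lim) auto
qed

section \<open>Slopes and the maxima of tilted partial sums\<close>

lemma ex_max_point: "\<exists>k\<le>n. \<forall>i\<le>n. S i - a * real i \<le> S k - a * real k"
proof -
  have "Max ((\<lambda>i. S i - a * real i) ` {..n}) \<in> (\<lambda>i. S i - a * real i) ` {..n}"
    by (rule Max_in) auto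
  then obtain k where k: "k \<le> n" "Max ((\<lambda>i. S i - a * real i) ` {..n}) = S k - a * real k"
    by blast
  have "S i - a * real i \<le> S k - a * real k" if "i \<le> n" for i
    unfolding k(2)[symmetric] using that by (intro Max_ge) auto
  with k(1) show ?thesis by auto
qed

text \<open>A line of slope \<open>a\<close> above all the points is a majorant, so subtracting a
  linear function does not let the majorant rise above the maximum over the points.\<close>

lemma majorant_le_max_point:
  assumes "\<And>i. i \<le> n \<Longrightarrow> S i - a * real i \<le> b" "j \<le> n"
  shows "majorant (c + real j) - a * real j \<le> b"
  using majorant_le_affine[of a b "c + real j"] assms by (simp add: algebra_simps)

text \<open>As the slopes decrease, those above \<open>a\<close> form an initial segment, and
  \<open>m\<close> is its length.\<close>

lemma majorant_slope_threshold:
  obtains m where "m \<le> n" "\<And>j. j < m \<Longrightarrow> a < majorant_slope j"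
    "\<And>j. m \<le> j \<Longrightarrow> j < n \<Longrightarrow> majorant_slope j \<le> a"
proof -
  define m where "m = (LEAST j. n \<le> j \<or> majorant_slope j \<le> a)"
  have 1: "n \<le> m \<or> majorant_slope m \<le> a" unfolding m_def by (rule LeastI[of _ n]) simp
  have 2: "m \<le> n" unfolding m_def by (rule Least_le) simp
  have 3: "a < majorant_slope j" if "j < m" for j
    using not_less_Least[OF that[unfolded m_def]] by auto
  have 4: "majorant_slope j \<le> a" if "m \<le> j" "j < n" for j
    using 1 that majorant_slope_antimono[OF that] by auto
  show ?thesis using 2 3 4 by (rule that)
qed

text \<open>For the upper bound the slopes above \<open>a\<close> are the first \<open>m\<close>, so
  their excesses telescope to the tilted majorant at \<open>m\<close>, which cannot exceed the
  maximum over the points. For the lower bound, each tilted point lies below the tilted majorant, a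
  partial sum of excesses that only grows when these are replaced by positive parts and the
  remaining ones are added.\<close>

lemma sum_pos_part_majorant_slope:
  "(\<Sum>j<n. max 0 (majorant_slope j - a)) = Max ((\<lambda>k. S k - S 0 - a * real k) ` {..n})"
proof (rule antisym)
  obtain m where m: "m \<le> n" "\<And>j. j < m \<Longrightarrow> a < majorant_slope j"
    "\<And>j. m \<le> j \<Longrightarrow> j < n \<Longrightarrow> majorant_slope j \<le> a"
    by (rule majorant_slope_threshold[of a]) blast
  have "(\<Sum>j<n. max 0 (majorant_slope j - a)) = (\<Sum>j<m. max 0 (majorant_slope j - a))"
    using m by (intro sum.mono_neutral_right) (auto simp: max_def intro: antisym)
  also have "\<dots> = (\<Sum>j<m. majorant_slope j - a)"
    using m(2) by (intro sum.cong) (auto simp: max_def dest: less_imp_le)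
  also have "\<dots> = majorant (c + real m) - a * real m - S 0"
    using majorant_diff_eq_sum[of 0 m]
    by (simp add: sum_subtractf majorant_left atLeast0LessThan algebra_simps)
  also have "\<dots> \<le> Max ((\<lambda>k. S k - S 0 - a * real k) ` {..n})"
  proof -
    have "S k - a * real k \<le> Max ((\<lambda>k. S k - S 0 - a * real k) ` {..n}) + S 0" if "k \<le> n" for k
    proof -
      have "S k - S 0 - a * real k \<le> Max ((\<lambda>k. S k - S 0 - a * real k) ` {..n})"
        using that by (intro Max_ge) auto
      then show ?thesis by linarith
    qed
    from majorant_le_max_point[OF this m(1)] show ?thesis by linarith
  qed
  finally show "(\<Sum>j<n. max 0 (majorant_slope j - a)) \<le> Max ((\<lambda>k. S k - S 0 - a * real k) ` {..n})" .
  show "Max ((\<lambda>k. S k - S 0 - a * real k) ` {..n}) \<le> (\<Sum>j<n. max 0 (majorant_slope j - a))"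
  proof (subst Max_le_iff; safe?)
    fix k assume k: "k \<le> n"
    have "S k - S 0 - a * real k \<le> majorant (c + real k) - majorant (c + real 0) - a * real k"
      using le_majorant[OF k] majorant_left by simp
    also have "\<dots> = (\<Sum>j\<in>{0..<k}. majorant_slope j - a)"
      using majorant_diff_eq_sum[of 0 k] by (simp add: sum_subtractf algebra_simps)
    also have "\<dots> \<le> (\<Sum>j\<in>{0..<k}. max 0 (majorant_slope j - a))"
      by (intro sum_mono) auto
    also have "\<dots> \<le> (\<Sum>j<n. max 0 (majorant_slope j - a))"
      using k by (intro sum_mono2) auto
    finally show "S k - S 0 - a * real k \<le> (\<Sum>j<n. max 0 (majorant_slope j - a))" .
  qed auto
qed

text \<open>Measurability of the slopes rests on this lemma and the next, which compare finitely
  many linear expressions in \<open>S\<close>. If slope \<open>j\<close> exceeds \<open>a\<close>,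
  the tilted majorant increases strictly up to \<open>Suc j\<close>, so a maximiser of the tilted
  points lies beyond \<open>j\<close> and beats strictly everything up to \<open>j\<close>.\<close>

lemma less_majorant_slopeD:
  assumes "j < n" "a < majorant_slope j"
  shows "\<exists>k\<in>{Suc j..n}. \<forall>i\<le>j. S i - a * real i < S k - a * real k"
proof -
  obtain k where k: "k \<le> n" "\<And>i. i \<le> n \<Longrightarrow> S i - a * real i \<le> S k - a * real k"
    using ex_max_point by blast
  have *: "S i - a * real i < S k - a * real k" if "i \<le> j" for i
  proof -
    have "(\<Sum>l\<in>{i..<Suc j}. a) < (\<Sum>l\<in>{i..<Suc j}. majorant_slope l)"
      using that assms(1)
      by (intro sum_strict_mono less_le_trans[OF assms(2) majorant_slope_antimono]) auto
    then have "a * (real (Suc j) - real i) < majorant (c + real (Suc j)) - majorant (c + real i)"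
      using majorant_diff_eq_sum[of i "Suc j"] that
      by (simp add: of_nat_diff Suc_diff_le algebra_simps)
    moreover have "majorant (c + real (Suc j)) - a * real (Suc j) \<le> S k - a * real k"
      using k assms(1) by (intro majorant_le_max_point) auto
    moreover have "S i \<le> majorant (c + real i)" using that assms by (intro le_majorant) auto
    ultimately show ?thesis by (simp add: algebra_simps)
  qed
  then have "\<not> k \<le> j" by blast
  then show ?thesis using * k(1) by (intro bexI[of _ k]) auto
qed

text \<open>If slope \<open>j\<close> were below \<open>a\<close>, the tilted majorant would
  decrease strictly from \<open>j\<close> on, which would force a maximiser of the tilted points
  into the range up to \<open>j\<close>. Only a weak inequality results; a rational level strictly
  above the one of interest later makes up for this.\<close>

lemma le_majorant_slopeI:
  assumes "j < n" "k \<in> {Suc j..n}" "\<And>i. i \<le> j \<Longrightarrow> S i - a * real i < S k - a * real k"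
  shows "a \<le> majorant_slope j"
proof (rule ccontr)
  assume "\<not> a \<le> majorant_slope j"
  then have less: "majorant_slope j < a" by simp
  obtain k' where k': "k' \<le> n" "\<And>i. i \<le> n \<Longrightarrow> S i - a * real i \<le> S k' - a * real k'"
    using ex_max_point by blast
  have "k' \<le> j"
  proof (rule ccontr)
    assume nle: "\<not> k' \<le> j"
    have "(\<Sum>l\<in>{j..<k'}. majorant_slope l) < (\<Sum>l\<in>{j..<k'}. a)"
      using nle k'(1) by (intro sum_strict_mono le_less_trans[OF majorant_slope_antimono less]) auto
    then have "majorant (c + real k') - majorant (c + real j) < a * (real k' - real j)"
      using majorant_diff_eq_sum[of j k'] nle by (simp add: of_nat_diff algebra_simps)
    moreover have "majorant (c + real j) - a * real j \<le> S k' - a * real k'"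
      using k' assms(1) by (intro majorant_le_max_point) auto
    moreover have "S k' \<le> majorant (c + real k')" using k' by (intro le_majorant)
    ultimately show False by (simp add: algebra_simps)
  qed
  then show False using assms(3)[of k'] k'(2)[of k] assms(2) by auto
qed

end

definition psum :: "(nat \<Rightarrow> real) \<Rightarrow> nat \<Rightarrow> real" where
  "psum w k = (\<Sum>i<k. w i)"

text \<open>A block of \<open>n\<close> entries from \<open>r\<close> on ends at s = r + n - 1 and
  has n + 1 points starting at abscissa r - 1. Entry \<open>r + j\<close> is then the slope of the
  cell numbered \<open>j\<close>.\<close>

lemma gren_eq_majorant_slope:
  assumes "j < n"
  shows "gren r (r + n - 1) w (r + j) = majorant_slope (real r - 1) n (psum (\<lambda>i. w (r + i))) j"
proof -
  have psum: "(\<Sum>i\<in>{r..<r + k}. w i) = psum (\<lambda>i. w (r + i)) k" for k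
    unfolding psum_def using sum.shift_bounds_nat_ivl[of w 0 r k]
    by (simp add: atLeast0LessThan add.commute)
  have idx: "{r..Suc (r + n - 1)} = (\<lambda>k. r + k) ` {..n}"
    using assms by (simp add: image_add_atLeastAtMost flip: atLeast0AtMost)
  have "(\<lambda>k. (real k - 1, \<Sum>i\<in>{r..<k}. w i)) ` {r..Suc (r + n - 1)}
    = (\<lambda>k. (real r - 1 + real k, psum (\<lambda>i. w (r + i)) k)) ` {..n}"
    unfolding idx image_image by (intro image_cong) (auto simp: psum)
  moreover have "real (r + n - 1) = real r - 1 + real n" using assms by (simp add: of_nat_diff)
  moreover have "real (r + j) = real r - 1 + real (Suc j)" by simp
  ultimately show ?thesis
    unfolding gren_def using left_slope_majorant[OF assms, of "real r - 1" "psum (\<lambda>i. w (r + i))"]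
    unfolding majorant_def by simp
qed

section \<open>The Cramer-Wold device\<close>

text \<open>Dividing the weights by their total mass turns them into probability densities, under
  which Levy's theorem identifies the laws of \<open>X\<close> and \<open>X'\<close>. The masses
  agree by the case s = 0; if they vanish, so do the weights almost everywhere.\<close>

lemma weighted_law_eqI:
  fixes X W :: "'a \<Rightarrow> real" and X' W' :: "'b \<Rightarrow> real"
  assumes [measurable]: "X \<in> borel_measurable M" "X' \<in> borel_measurable N"
    and int: "integrable M W" "integrable N W'"
    and nonneg: "\<And>\<omega>. 0 \<le> W \<omega>" "\<And>\<omega>. 0 \<le> W' \<omega>"
    and char: "\<And>s. (CLINT \<omega>|M. W \<omega> *\<^sub>R iexp (s * X \<omega>)) = (CLINT \<omega>|N. W' \<omega> *\<^sub>R iexp (s * X' \<omega>))"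
    and B[measurable]: "B \<in> sets borel"
  shows "(\<integral>\<omega>. W \<omega> * indicator B (X \<omega>) \<partial>M) = (\<integral>\<omega>. W' \<omega> * indicator B (X' \<omega>) \<partial>N)"
proof -
  have [measurable]: "W \<in> borel_measurable M" "W' \<in> borel_measurable N"
    using int by auto
  define c where "c = (\<integral>\<omega>. W \<omega> \<partial>M)"
  have c': "c = (\<integral>\<omega>. W' \<omega> \<partial>N)"
  proof -
    have "complex_of_real c = complex_of_real (\<integral>\<omega>. W' \<omega> \<partial>N)"
      unfolding c_def using char[of 0] by (simp add: scaleR_conv_of_real)
    then show ?thesis using of_real_eq_iff by blast
  qed
  show ?thesis
  proof (cases "c = 0")
    case True
    have "AE \<omega> in M. W \<omega> = 0"
      using True nonneg int integral_nonneg_eq_0_iff_AE[of M W] by (simp add: c_def)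
    moreover have "AE \<omega> in N. W' \<omega> = 0"
      using True nonneg int integral_nonneg_eq_0_iff_AE[of N W'] by (simp add: c')
    ultimately have "(\<integral>\<omega>. W \<omega> * indicator B (X \<omega>) \<partial>M) = 0"
      "(\<integral>\<omega>. W' \<omega> * indicator B (X' \<omega>) \<partial>N) = 0"
      by (auto intro!: integral_eq_zero_AE elim: eventually_mono)
    then show ?thesis by simp
  next
    case False
    have c: "0 < c" using False nonneg(1) unfolding c_def
      by (metis Bochner_Integration.integral_nonneg less_eq_real_def)
    define P Q where "P = density M (\<lambda>\<omega>. W \<omega> / c)" and "Q = density N (\<lambda>\<omega>. W' \<omega> / c)"
    have P: "prob_space P"
    proof (rule prob_spaceI)
      have "emeasure P (space P) = (\<integral>\<^sup>+\<omega>. ennreal (W \<omega> / c) \<partial>M)"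
        by (simp add: P_def emeasure_density cong: nn_integral_cong_simp)
      also have "\<dots> = ennreal (\<integral>\<omega>. W \<omega> / c \<partial>M)"
        using int nonneg c by (intro nn_integral_eq_integral) auto
      finally show "emeasure P (space P) = 1" using c c_def by simp
    qed
    have Q: "prob_space Q"
    proof (rule prob_spaceI)
      have "emeasure Q (space Q) = (\<integral>\<^sup>+\<omega>. ennreal (W' \<omega> / c) \<partial>N)"
        by (simp add: Q_def emeasure_density cong: nn_integral_cong_simp)
      also have "\<dots> = ennreal (\<integral>\<omega>. W' \<omega> / c \<partial>N)"
        using int nonneg c by (intro nn_integral_eq_integral) auto
      finally show "emeasure Q (space Q) = 1" using c c' by simp
    qed
    have [measurable]: "X \<in> borel_measurable P" "X' \<in> borel_measurable Q"
      by (simp_all add: P_def Q_def)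
    have intP: "(\<integral>\<omega>. g (X \<omega>) \<partial>P) = (\<integral>\<omega>. W \<omega> *\<^sub>R g (X \<omega>) \<partial>M) /\<^sub>R c"
      and intQ: "(\<integral>\<omega>. g (X' \<omega>) \<partial>Q) = (\<integral>\<omega>. W' \<omega> *\<^sub>R g (X' \<omega>) \<partial>N) /\<^sub>R c"
      if [measurable]: "g \<in> borel_measurable borel"
      for g :: "real \<Rightarrow> 'c::{banach, second_countable_topology}"
    proof -
      show "(\<integral>\<omega>. g (X \<omega>) \<partial>P) = (\<integral>\<omega>. W \<omega> *\<^sub>R g (X \<omega>) \<partial>M) /\<^sub>R c"
        unfolding P_def using nonneg c
        by (subst integral_density) (auto simp: divide_inverse mult.commute simp flip: integral_scaleR_right scaleR_scaleR)
      show "(\<integral>\<omega>. g (X' \<omega>) \<partial>Q) = (\<integral>\<omega>. W' \<omega> *\<^sub>R g (X' \<omega>) \<partial>N) /\<^sub>R c"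
        unfolding Q_def using nonneg c
        by (subst integral_density) (auto simp: divide_inverse mult.commute simp flip: integral_scaleR_right scaleR_scaleR)
    qed
    have "distr P borel X = distr Q borel X'"
    proof (rule Levy_uniqueness)
      show "real_distribution (distr P borel X)" "real_distribution (distr Q borel X')"
        using P Q by (auto intro!: prob_space.real_distribution_distr)
      show "char (distr P borel X) = char (distr Q borel X')"
      proof
        fix s
        show "char (distr P borel X) s = char (distr Q borel X') s"
          unfolding char_def
          using intP[of "\<lambda>x. iexp (s * x)"] intQ[of "\<lambda>x. iexp (s * x)"] char[of s]
          by (simp add: integral_distr)
      qed
    qed
    then have "(\<integral>x. indicator B x \<partial>distr P borel X) = (\<integral>x. indicator B x \<partial>distr Q borel X' :: real)"
      by simp
    then have "(\<integral>\<omega>. indicator B (X \<omega>) \<partial>P) = (\<integral>\<omega>. indicator B (X' \<omega>) \<partial>Q :: real)"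
      by (subst (asm) (1 2) integral_distr) auto
    then show ?thesis
      using c intP[of "indicator B :: real \<Rightarrow> real"] intQ[of "indicator B :: real \<Rightarrow> real"] by simp
  qed
qed

lemma (in prob_space) integrable_weight_iexp:
  assumes [measurable]: "D \<in> borel_measurable M" "T \<in> borel_measurable M"
    and "\<And>\<omega>. 0 \<le> D \<omega>" "\<And>\<omega>. D \<omega> \<le> 1"
  shows "complex_integrable M (\<lambda>\<omega>. D \<omega> *\<^sub>R iexp (T \<omega>))"
  using assms(3,4) by (intro integrable_const_bound[where B=1]) auto

text \<open>Euler's formulas split a trigonometric weight into exponentials with phases
  \<open>T\<close> and \<open>- T\<close>. The added 1 makes the weight nonnegative, as the
  uniqueness theorem for weighted laws demands.\<close>

lemma (in prob_space) integral_weight_trig: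
  fixes s :: real
  assumes [measurable]: "D \<in> borel_measurable M" "T \<in> borel_measurable M" "X \<in> borel_measurable M"
    and D: "\<And>\<omega>. 0 \<le> D \<omega>" "\<And>\<omega>. D \<omega> \<le> 1"
  shows "(CLINT \<omega>|M. (D \<omega> * (1 + cos (T \<omega>))) *\<^sub>R iexp (s * X \<omega>)) =
      (CLINT \<omega>|M. D \<omega> *\<^sub>R iexp (s * X \<omega>))
      + ((CLINT \<omega>|M. D \<omega> *\<^sub>R iexp (s * X \<omega> + T \<omega>)) + (CLINT \<omega>|M. D \<omega> *\<^sub>R iexp (s * X \<omega> - T \<omega>))) / 2"
    and "(CLINT \<omega>|M. (D \<omega> * (1 + sin (T \<omega>))) *\<^sub>R iexp (s * X \<omega>)) =
      (CLINT \<omega>|M. D \<omega> *\<^sub>R iexp (s * X \<omega>))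
      + ((CLINT \<omega>|M. D \<omega> *\<^sub>R iexp (s * X \<omega> + T \<omega>)) - (CLINT \<omega>|M. D \<omega> *\<^sub>R iexp (s * X \<omega> - T \<omega>))) / (2 * \<i>)"
proof -
  have int: "complex_integrable M (\<lambda>\<omega>. D \<omega> *\<^sub>R iexp (s * X \<omega>))"
    "complex_integrable M (\<lambda>\<omega>. D \<omega> *\<^sub>R iexp (s * X \<omega> + T \<omega>))"
    "complex_integrable M (\<lambda>\<omega>. D \<omega> *\<^sub>R iexp (s * X \<omega> - T \<omega>))"
    by (intro integrable_weight_iexp D; measurable)+
  have "(D \<omega> * (1 + cos (T \<omega>))) *\<^sub>R iexp (s * X \<omega>) =
    D \<omega> *\<^sub>R iexp (s * X \<omega>) + (D \<omega> *\<^sub>R iexp (s * X \<omega> + T \<omega>) + D \<omega> *\<^sub>R iexp (s * X \<omega> - T \<omega>)) / 2" for \<omega>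
    by (simp add: scaleR_conv_of_real ring_distribs exp_add exp_diff cos_exp_eq exp_minus
        field_simps flip: cos_of_real)
  then show "(CLINT \<omega>|M. (D \<omega> * (1 + cos (T \<omega>))) *\<^sub>R iexp (s * X \<omega>)) =
      (CLINT \<omega>|M. D \<omega> *\<^sub>R iexp (s * X \<omega>))
      + ((CLINT \<omega>|M. D \<omega> *\<^sub>R iexp (s * X \<omega> + T \<omega>)) + (CLINT \<omega>|M. D \<omega> *\<^sub>R iexp (s * X \<omega> - T \<omega>))) / 2"
    using int by (simp del: of_real_add of_real_diff of_real_mult)
  have "(D \<omega> * (1 + sin (T \<omega>))) *\<^sub>R iexp (s * X \<omega>) =
    D \<omega> *\<^sub>R iexp (s * X \<omega>) + (D \<omega> *\<^sub>R iexp (s * X \<omega> + T \<omega>) - D \<omega> *\<^sub>R iexp (s * X \<omega> - T \<omega>)) / (2 * \<i>)" for \<omega>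
    by (simp add: scaleR_conv_of_real ring_distribs exp_add exp_diff sin_exp_eq exp_minus
        field_simps flip: sin_of_real)
  then show "(CLINT \<omega>|M. (D \<omega> * (1 + sin (T \<omega>))) *\<^sub>R iexp (s * X \<omega>)) =
      (CLINT \<omega>|M. D \<omega> *\<^sub>R iexp (s * X \<omega>))
      + ((CLINT \<omega>|M. D \<omega> *\<^sub>R iexp (s * X \<omega> + T \<omega>)) - (CLINT \<omega>|M. D \<omega> *\<^sub>R iexp (s * X \<omega> - T \<omega>))) / (2 * \<i>)"
    using int by (simp del: of_real_add of_real_diff of_real_mult)
qed

text \<open>The way back: real and imaginary parts of the exponential are recovered from the two
  nonnegative weights by removing the added 1.\<close>

lemma (in prob_space) integral_weight_iexp_eq:
  assumes [measurable]: "D \<in> borel_measurable M" "T \<in> borel_measurable M"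
    and D: "\<And>\<omega>. 0 \<le> D \<omega>" "\<And>\<omega>. D \<omega> \<le> 1"
    and E[measurable]: "E \<in> borel_measurable M" "\<And>\<omega>. 0 \<le> E \<omega>" "\<And>\<omega>. E \<omega> \<le> 1"
  shows "(CLINT \<omega>|M. (D \<omega> * E \<omega>) *\<^sub>R iexp (T \<omega>)) =
    complex_of_real ((\<integral>\<omega>. (D \<omega> * (1 + cos (T \<omega>))) * E \<omega> \<partial>M) - (\<integral>\<omega>. D \<omega> * E \<omega> \<partial>M))
    + \<i> * complex_of_real ((\<integral>\<omega>. (D \<omega> * (1 + sin (T \<omega>))) * E \<omega> \<partial>M) - (\<integral>\<omega>. D \<omega> * E \<omega> \<partial>M))"
proof -
  have DE: "\<bar>D \<omega> * E \<omega>\<bar> \<le> 1" for \<omega>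
    using D E by (simp add: abs_mult mult_le_one)
  have int: "integrable M (\<lambda>\<omega>. D \<omega> * E \<omega>)"
    using DE by (intro integrable_const_bound[where B=1]) auto
  have int_c: "integrable M (\<lambda>\<omega>. D \<omega> * E \<omega> * cos (T \<omega>))"
    using DE by (intro integrable_const_bound[where B=1]) (auto simp: abs_mult[of _ "cos _"] mult_le_one)
  have int_s: "integrable M (\<lambda>\<omega>. D \<omega> * E \<omega> * sin (T \<omega>))"
    using DE by (intro integrable_const_bound[where B=1]) (auto simp: abs_mult[of _ "sin _"] mult_le_one)
  have "(CLINT \<omega>|M. (D \<omega> * E \<omega>) *\<^sub>R iexp (T \<omega>)) =
    (CLINT \<omega>|M. complex_of_real (D \<omega> * E \<omega> * cos (T \<omega>)) + \<i> * complex_of_real (D \<omega> * E \<omega> * sin (T \<omega>)))"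
    by (intro Bochner_Integration.integral_cong)
      (auto simp: exp_Euler scaleR_conv_of_real algebra_simps simp flip: cos_of_real sin_of_real)
  also have "\<dots> = complex_of_real (\<integral>\<omega>. D \<omega> * E \<omega> * cos (T \<omega>) \<partial>M)
      + \<i> * complex_of_real (\<integral>\<omega>. D \<omega> * E \<omega> * sin (T \<omega>) \<partial>M)"
    using int_c int_s by (subst Bochner_Integration.integral_add) (auto simp del: of_real_mult)
  also have "(\<integral>\<omega>. D \<omega> * E \<omega> * cos (T \<omega>) \<partial>M)
    = (\<integral>\<omega>. (D \<omega> * (1 + cos (T \<omega>))) * E \<omega> \<partial>M) - (\<integral>\<omega>. D \<omega> * E \<omega> \<partial>M)"
    using Bochner_Integration.integral_add[OF int int_c] by (simp add: algebra_simps)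
  also have "(\<integral>\<omega>. D \<omega> * E \<omega> * sin (T \<omega>) \<partial>M)
    = (\<integral>\<omega>. (D \<omega> * (1 + sin (T \<omega>))) * E \<omega> \<partial>M) - (\<integral>\<omega>. D \<omega> * E \<omega> \<partial>M)"
    using Bochner_Integration.integral_add[OF int int_s] by (simp add: algebra_simps)
  finally show ?thesis .
qed

text \<open>The exponentials are traded for indicators one coordinate at a time: weighted by the nonnegative
  functions \<open>1 + cos T\<close> and \<open>1 + sin T\<close> of the remaining coordinates, the law of a single coordinate is
  determined by Levy's one-dimensional uniqueness theorem.\<close>

lemma cramer_wold_mixed:
  fixes X :: "'i \<Rightarrow> 'a \<Rightarrow> real" and X' :: "'i \<Rightarrow> 'b \<Rightarrow> real"
  assumes "prob_space M" "prob_space N" "finite J"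
    and X[measurable]: "\<And>i. i \<in> J \<Longrightarrow> X i \<in> borel_measurable M"
    and X'[measurable]: "\<And>i. i \<in> J \<Longrightarrow> X' i \<in> borel_measurable N"
    and char: "\<And>t. (CLINT \<omega>|M. iexp (\<Sum>i\<in>J. t i * X i \<omega>)) = (CLINT \<omega>|N. iexp (\<Sum>i\<in>J. t i * X' i \<omega>))"
    and K: "K \<subseteq> J" and A: "\<And>i. A i \<in> sets borel"
  shows "(CLINT \<omega>|M. (\<Prod>i\<in>K. indicator (A i) (X i \<omega>)) *\<^sub>R iexp (\<Sum>i\<in>J - K. t i * X i \<omega>))
       = (CLINT \<omega>|N. (\<Prod>i\<in>K. indicator (A i) (X' i \<omega>)) *\<^sub>R iexp (\<Sum>i\<in>J - K. t i * X' i \<omega>))"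
proof -
  interpret M: prob_space M by fact
  interpret N: prob_space N by fact
  have "finite K" using K \<open>finite J\<close> by (rule finite_subset)
  then show ?thesis using K
  proof (induction K arbitrary: t rule: finite_induct)
    case empty
    show ?case using char by simp
  next
    case (insert k K)
    define R where "R = J - insert k K"
    have R: "J - K = insert k R" "k \<notin> R" "finite R" "R \<subseteq> J" "k \<in> J" "K \<subseteq> J"
      using insert \<open>finite J\<close> by (auto simp: R_def)
    have [measurable]: "i \<in> R \<Longrightarrow> X i \<in> borel_measurable M" "i \<in> R \<Longrightarrow> X' i \<in> borel_measurable N"
       "i \<in> K \<Longrightarrow> X i \<in> borel_measurable M" "i \<in> K \<Longrightarrow> X' i \<in> borel_measurable N"
       "X k \<in> borel_measurable M" "X' k \<in> borel_measurable N" "A i \<in> sets borel" for i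
      using R A X X' by auto
    define D T D' T' where "D \<omega> = (\<Prod>i\<in>K. indicator (A i) (X i \<omega>) :: real)"
      and "T \<omega> = (\<Sum>i\<in>R. t i * X i \<omega>)"
      and "D' \<omega>' = (\<Prod>i\<in>K. indicator (A i) (X' i \<omega>') :: real)"
      and "T' \<omega>' = (\<Sum>i\<in>R. t i * X' i \<omega>')" for \<omega> \<omega>'
    have [measurable]: "D \<in> borel_measurable M" "T \<in> borel_measurable M"
      "D' \<in> borel_measurable N" "T' \<in> borel_measurable N"
      unfolding D_def[abs_def] T_def[abs_def] D'_def[abs_def] T'_def[abs_def] by measurable
    have D: "0 \<le> D \<omega>" "D \<omega> \<le> 1" and D': "0 \<le> D' \<omega>'" "D' \<omega>' \<le> 1" for \<omega> \<omega>'
      unfolding D_def D'_def by (auto intro!: prod_nonneg prod_le_1)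
    \<comment> \<open>The induction hypothesis holds for all coefficients. Scaling those other than
      the one of \<open>k\<close> by 0, 1 and -1 supplies the three phases into which the
      trigonometric weights decompose.\<close>
    have split: "(\<Sum>i\<in>J - K. (if i = k then s else a * t i) * X i \<omega>) = s * X k \<omega> + a * T \<omega>"
      "(\<Sum>i\<in>J - K. (if i = k then s else a * t i) * X' i \<omega>') = s * X' k \<omega>' + a * T' \<omega>'"
      for s a \<omega> \<omega>'
    proof -
      have "(\<Sum>i\<in>R. (if i = k then s else a * t i) * X i \<omega>) = (\<Sum>i\<in>R. a * (t i * X i \<omega>))"
        "(\<Sum>i\<in>R. (if i = k then s else a * t i) * X' i \<omega>') = (\<Sum>i\<in>R. a * (t i * X' i \<omega>'))"
        using R(2) by (auto intro!: sum.cong)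
      then show "(\<Sum>i\<in>J - K. (if i = k then s else a * t i) * X i \<omega>) = s * X k \<omega> + a * T \<omega>"
        "(\<Sum>i\<in>J - K. (if i = k then s else a * t i) * X' i \<omega>') = s * X' k \<omega>' + a * T' \<omega>'"
        using R(2,3) by (simp_all add: R(1) T_def T'_def sum_distrib_left)
    qed
    have IH: "(CLINT \<omega>|M. D \<omega> *\<^sub>R iexp (s * X k \<omega> + a * T \<omega>)) = (CLINT \<omega>|N. D' \<omega> *\<^sub>R iexp (s * X' k \<omega> + a * T' \<omega>))"
      for s a
      using insert.IH[OF R(6), of "\<lambda>i. if i = k then s else a * t i"]
      unfolding split D_def[symmetric] D'_def[symmetric] .
    have IH0: "(CLINT \<omega>|M. D \<omega> *\<^sub>R iexp (s * X k \<omega>)) = (CLINT \<omega>|N. D' \<omega> *\<^sub>R iexp (s * X' k \<omega>))"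
      and IH1: "(CLINT \<omega>|M. D \<omega> *\<^sub>R iexp (s * X k \<omega> + T \<omega>)) = (CLINT \<omega>|N. D' \<omega> *\<^sub>R iexp (s * X' k \<omega> + T' \<omega>))"
      and IHm: "(CLINT \<omega>|M. D \<omega> *\<^sub>R iexp (s * X k \<omega> - T \<omega>)) = (CLINT \<omega>|N. D' \<omega> *\<^sub>R iexp (s * X' k \<omega> - T' \<omega>))"
      for s
      using IH[of s 0] IH[of s 1] IH[of s "-1"] by simp_all
    have trig_bounds: "0 \<le> 1 + cos x" "0 \<le> 1 + sin x" "1 + cos x \<le> 2" "1 + sin x \<le> 2" for x :: real
      using cos_ge_minus_one[of x] sin_ge_minus_one[of x] cos_le_one[of x] sin_le_one[of x] by linarith+
    have bnd: "D \<omega> * y \<le> 2" "D' \<omega>' * y \<le> 2" if "0 \<le> y" "y \<le> 2" for y \<omega> \<omega>'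
      using mult_mono[of "D \<omega>" 1 y 2] mult_mono[of "D' \<omega>'" 1 y 2] D D' that by simp_all
    have "(\<integral>\<omega>. D \<omega> * indicator (A k) (X k \<omega>) \<partial>M) = (\<integral>\<omega>. D' \<omega> * indicator (A k) (X' k \<omega>) \<partial>N)"
      using D D' IH0 A
      by (intro weighted_law_eqI M.integrable_const_bound[where B=1] N.integrable_const_bound[where B=1]) auto
    moreover have "(\<integral>\<omega>. (D \<omega> * (1 + cos (T \<omega>))) * indicator (A k) (X k \<omega>) \<partial>M)
      = (\<integral>\<omega>. (D' \<omega> * (1 + cos (T' \<omega>))) * indicator (A k) (X' k \<omega>) \<partial>N)"
    proof (intro weighted_law_eqI M.integrable_const_bound[where B=2] N.integrable_const_bound[where B=2])
      show "(CLINT \<omega>|M. (D \<omega> * (1 + cos (T \<omega>))) *\<^sub>R iexp (s * X k \<omega>))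
        = (CLINT \<omega>|N. (D' \<omega> * (1 + cos (T' \<omega>))) *\<^sub>R iexp (s * X' k \<omega>))" for s
        by (subst M.integral_weight_trig N.integral_weight_trig;
            (use D D' in \<open>simp add: IH0 IH1 IHm del: of_real_add of_real_diff of_real_mult\<close>)?)+
    qed (use D D' trig_bounds bnd A in \<open>auto intro!: mult_nonneg_nonneg\<close>)
    moreover have "(\<integral>\<omega>. (D \<omega> * (1 + sin (T \<omega>))) * indicator (A k) (X k \<omega>) \<partial>M)
      = (\<integral>\<omega>. (D' \<omega> * (1 + sin (T' \<omega>))) * indicator (A k) (X' k \<omega>) \<partial>N)"
    proof (intro weighted_law_eqI M.integrable_const_bound[where B=2] N.integrable_const_bound[where B=2])
      show "(CLINT \<omega>|M. (D \<omega> * (1 + sin (T \<omega>))) *\<^sub>R iexp (s * X k \<omega>))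
        = (CLINT \<omega>|N. (D' \<omega> * (1 + sin (T' \<omega>))) *\<^sub>R iexp (s * X' k \<omega>))" for s
        by (subst M.integral_weight_trig N.integral_weight_trig;
            (use D D' in \<open>simp add: IH0 IH1 IHm del: of_real_add of_real_diff of_real_mult\<close>)?)+
    qed (use D D' trig_bounds bnd A in \<open>auto intro!: mult_nonneg_nonneg\<close>)
    ultimately have "(CLINT \<omega>|M. (D \<omega> * indicator (A k) (X k \<omega>)) *\<^sub>R iexp (T \<omega>))
      = (CLINT \<omega>|N. (D' \<omega> * indicator (A k) (X' k \<omega>)) *\<^sub>R iexp (T' \<omega>))"
      using D D' by (simp add: M.integral_weight_iexp_eq N.integral_weight_iexp_eq)
    then show ?case
      using insert.hyps by (simp add: D_def D'_def T_def T'_def R_def mult.commute)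
  qed
qed

text \<open>With all coordinates moved from the exponential to indicators, the mixed identity says
  that the two joint laws agree on boxes, and these determine a measure on a finite product.\<close>

theorem cramer_wold:
  fixes X :: "'i \<Rightarrow> 'a \<Rightarrow> real" and X' :: "'i \<Rightarrow> 'b \<Rightarrow> real"
  assumes "prob_space M" "prob_space N" "finite J"
    and X[measurable]: "\<And>i. i \<in> J \<Longrightarrow> X i \<in> borel_measurable M"
    and X'[measurable]: "\<And>i. i \<in> J \<Longrightarrow> X' i \<in> borel_measurable N"
    and law: "\<And>t. distr M borel (\<lambda>\<omega>. \<Sum>i\<in>J. t i * X i \<omega>) = distr N borel (\<lambda>\<omega>. \<Sum>i\<in>J. t i * X' i \<omega>)"
  shows "distr M (Pi\<^sub>M J (\<lambda>_. borel)) (\<lambda>\<omega>. \<lambda>i\<in>J. X i \<omega>) = distr N (Pi\<^sub>M J (\<lambda>_. borel)) (\<lambda>\<omega>. \<lambda>i\<in>J. X' i \<omega>)"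
    (is "distr M ?P ?X = distr N ?P ?X'")
proof -
  interpret M: prob_space M by fact
  interpret N: prob_space N by fact
  have [measurable]: "?X \<in> measurable M ?P" "?X' \<in> measurable N ?P"
    by measurable
  have char: "(CLINT \<omega>|M. iexp (\<Sum>i\<in>J. t i * X i \<omega>)) = (CLINT \<omega>|N. iexp (\<Sum>i\<in>J. t i * X' i \<omega>))" for t
  proof -
    have "(CLINT \<omega>|M. iexp (\<Sum>i\<in>J. t i * X i \<omega>)) = (CLINT x|distr M borel (\<lambda>\<omega>. \<Sum>i\<in>J. t i * X i \<omega>). iexp x)"
      by (subst integral_distr) auto
    also have "\<dots> = (CLINT \<omega>|N. iexp (\<Sum>i\<in>J. t i * X' i \<omega>))"
      unfolding law by (subst integral_distr) auto
    finally show ?thesis .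
  qed
  show ?thesis
  proof (rule measure_eqI_PiM_finite[OF \<open>finite J\<close>, of _ "\<lambda>_. borel" _ "\<lambda>_. \<Pi>\<^sub>E i\<in>J. UNIV"])
    fix A :: "'i \<Rightarrow> real set" assume A: "\<And>i. i \<in> J \<Longrightarrow> A i \<in> sets borel"
    \<comment> \<open>The mixed identity asks for a measurable set at every index, while the box
      provides one only for indices in \<open>J\<close>.\<close>
    define A' where "A' i = (if i \<in> J then A i else {})" for i
    have A': "A' i \<in> sets borel" for i using A by (simp add: A'_def)
    note [measurable] = A
    have box[measurable]: "Pi\<^sub>E J A \<in> sets ?P" using A \<open>finite J\<close> by (intro sets_PiM_I_finite) auto
    have ind: "indicator (Pi\<^sub>E J A) (\<lambda>i\<in>J. x i) = (\<Prod>i\<in>J. indicator (A' i) (x i) :: real)" for x :: "'i \<Rightarrow> real"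
    proof (cases "\<forall>i\<in>J. x i \<in> A i")
      case False
      then have "(\<Prod>i\<in>J. indicator (A' i) (x i) :: real) = 0"
        using \<open>finite J\<close> False by (auto simp: A'_def indicator_def)
      then show ?thesis using False by (auto simp: indicator_def PiE_iff)
    qed (auto simp: A'_def)
    have M: "complex_of_real (measure (distr M ?P ?X) (Pi\<^sub>E J A))
      = (CLINT \<omega>|M. (\<Prod>i\<in>J. indicator (A' i) (X i \<omega>)) *\<^sub>R iexp (\<Sum>i\<in>J - J. 0 * X i \<omega>))"
    proof -
      have "measure (distr M ?P ?X) (Pi\<^sub>E J A) = (\<integral>x. indicator (Pi\<^sub>E J A) x \<partial>distr M ?P ?X)"
        by simp
      also have "\<dots> = (\<integral>\<omega>. (\<Prod>i\<in>J. indicator (A' i) (X i \<omega>)) \<partial>M)"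
        by (subst integral_distr) (auto simp: ind)
      finally show ?thesis by (simp add: scaleR_conv_of_real del: of_real_prod)
    qed
    have N: "complex_of_real (measure (distr N ?P ?X') (Pi\<^sub>E J A))
      = (CLINT \<omega>|N. (\<Prod>i\<in>J. indicator (A' i) (X' i \<omega>)) *\<^sub>R iexp (\<Sum>i\<in>J - J. 0 * X' i \<omega>))"
    proof -
      have "measure (distr N ?P ?X') (Pi\<^sub>E J A) = (\<integral>x. indicator (Pi\<^sub>E J A) x \<partial>distr N ?P ?X')"
        by simp
      also have "\<dots> = (\<integral>\<omega>. (\<Prod>i\<in>J. indicator (A' i) (X' i \<omega>)) \<partial>N)"
        by (subst integral_distr) (auto simp: ind)
      finally show ?thesis by (simp add: scaleR_conv_of_real del: of_real_prod)
    qed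
    have "complex_of_real (measure (distr M ?P ?X) (Pi\<^sub>E J A))
        = complex_of_real (measure (distr N ?P ?X') (Pi\<^sub>E J A))"
      unfolding M N using assms(1-3) X X' char A' by (intro cramer_wold_mixed) auto
    then have "measure (distr M ?P ?X) (Pi\<^sub>E J A) = measure (distr N ?P ?X') (Pi\<^sub>E J A)"
      using of_real_eq_iff by blast
    then show "emeasure (distr M ?P ?X) (Pi\<^sub>E J A) = emeasure (distr N ?P ?X') (Pi\<^sub>E J A)"
      by (simp add: prob_space.finite_measure[OF M.prob_space_distr] prob_space.finite_measure[OF N.prob_space_distr]
          finite_measure.emeasure_eq_measure)
  qed (auto simp: space_PiM finite_measure.emeasure_finite[OF prob_space.finite_measure[OF M.prob_space_distr]]
      intro!: prod_algebraI_finite \<open>finite J\<close>)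
qed

section \<open>Spitzer's identity for exchangeable variables\<close>

definition max_psum :: "nat \<Rightarrow> (nat \<Rightarrow> real) \<Rightarrow> real" where
  "max_psum m x = Max (psum x ` {..m})"

definition exchangeable :: "'a measure \<Rightarrow> nat \<Rightarrow> (nat \<Rightarrow> 'a \<Rightarrow> real) \<Rightarrow> bool" where
  "exchangeable M n X \<longleftrightarrow> (\<forall>\<pi>. \<pi> permutes {..<n} \<longrightarrow>
     distr M (Pi\<^sub>M {..<n} (\<lambda>_. borel)) (\<lambda>\<omega>. \<lambda>i\<in>{..<n}. X (\<pi> i) \<omega>)
       = distr M (Pi\<^sub>M {..<n} (\<lambda>_. borel)) (\<lambda>\<omega>. \<lambda>i\<in>{..<n}. X i \<omega>))"

lemma psum_0 [simp]: "psum x 0 = 0"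
  by (simp add: psum_def)

lemma psum_cong: "(\<And>i. i < k \<Longrightarrow> x i = y i) \<Longrightarrow> psum x k = psum y k"
  by (simp add: psum_def)

lemma psum_restrict: "k \<le> n \<Longrightarrow> psum (restrict x {..<n}) k = psum x k"
  by (intro psum_cong) auto

lemma psum_Suc_shift: "psum x (Suc k) = x 0 + psum (\<lambda>i. x (Suc i)) k"
  unfolding psum_def by (simp add: sum.lessThan_Suc_shift del: sum.lessThan_Suc)

lemma psum_permute: "\<pi> permutes {..<k} \<Longrightarrow> psum (\<lambda>i. x (\<pi> i)) k = psum x k"
  unfolding psum_def by (simp add: sum.permute[of _ "{..<k}" x] o_def)

lemma psum_diff_const: "psum (\<lambda>i. x i - a) k = psum x k - a * real k"
  by (simp add: psum_def sum_subtractf mult.commute)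

lemma max_psum_0 [simp]: "max_psum 0 x = 0"
  by (simp add: max_psum_def)

lemma max_psum_Suc: "max_psum (Suc m) x = max (psum x (Suc m)) (max_psum m x)"
  unfolding max_psum_def atMost_Suc by simp

lemma max_psum_cong: "(\<And>i. i < m \<Longrightarrow> x i = y i) \<Longrightarrow> max_psum m x = max_psum m y"
  unfolding max_psum_def by (intro arg_cong[where f=Max] image_cong psum_cong) auto

lemma max_psum_nonneg: "0 \<le> max_psum m x"
  by (induction m) (auto simp: max_psum_Suc le_max_iff_disj)

text \<open>Every nonempty partial sum starts with \<open>x 0\<close>, and the empty one contributes
  the 0.\<close>

lemma max_psum_Suc_shift: "max_psum (Suc m) x = max 0 (x 0 + max_psum m (\<lambda>i. x (Suc i)))"
proof (induction m)
  case 0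
  then show ?case by (simp add: max_psum_Suc psum_Suc_shift)
next
  case (Suc m)
  have "max_psum (Suc (Suc m)) x = max (psum x (Suc (Suc m))) (max_psum (Suc m) x)"
    by (rule max_psum_Suc)
  also have "\<dots> = max 0 (x 0 + max (psum (\<lambda>i. x (Suc i)) (Suc m)) (max_psum m (\<lambda>i. x (Suc i))))"
    unfolding Suc psum_Suc_shift[of x] by (simp add: max_def)
  finally show ?case by (simp add: max_psum_Suc)
qed

lemma max_psum_Suc_cases:
  "max_psum (Suc m) x = (if 0 < psum x (Suc m) then x 0 + max_psum m (\<lambda>i. x (Suc i)) else max_psum m x)"
proof (cases "0 < psum x (Suc m)")
  case True
  then have "0 < max_psum (Suc m) x" unfolding max_psum_Suc[of m x] by simp
  then show ?thesis using True max_psum_Suc_shift[of m x] by (auto simp: max_def split: if_splits)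
next
  case False
  then show ?thesis using max_psum_nonneg[of m x] by (simp add: max_psum_Suc max_def)
qed

section \<open>Permutation invariance and the recursion for the expected maximum\<close>

lemma measurable_psum_PiM [measurable]:
  "k \<le> n \<Longrightarrow> (\<lambda>x. psum x k) \<in> borel_measurable (Pi\<^sub>M {..<n} (\<lambda>_. borel))"
  unfolding psum_def by (intro borel_measurable_sum measurable_component_singleton) auto

lemma measurable_max_psum_PiM [measurable]:
  "m \<le> n \<Longrightarrow> max_psum m \<in> borel_measurable (Pi\<^sub>M {..<n} (\<lambda>_. borel))"
proof (induction m)
  case 0
  have "max_psum 0 = (\<lambda>_. 0)" by auto
  then show ?case by simp
next
  case (Suc m)
  have "max_psum (Suc m) = (\<lambda>x. max (psum x (Suc m)) (max_psum m x))"
    using max_psum_Suc by auto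
  then show ?case using Suc by (auto intro!: borel_measurable_max measurable_psum_PiM)
qed

lemma exchangeable_integral:
  fixes F :: "(nat \<Rightarrow> real) \<Rightarrow> real"
  assumes "exchangeable M n X" "\<And>i. i < n \<Longrightarrow> X i \<in> borel_measurable M" "\<pi> permutes {..<n}"
    and [measurable]: "F \<in> borel_measurable (Pi\<^sub>M {..<n} (\<lambda>_. borel))"
  shows "(\<integral>\<omega>. F (\<lambda>i\<in>{..<n}. X (\<pi> i) \<omega>) \<partial>M) = (\<integral>\<omega>. F (\<lambda>i\<in>{..<n}. X i \<omega>) \<partial>M)"
proof -
  have [measurable]: "i < n \<Longrightarrow> X i \<in> borel_measurable M" "i < n \<Longrightarrow> X (\<pi> i) \<in> borel_measurable M" for i
    using assms(2) permutes_in_image[OF assms(3), of i] by auto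
  have [measurable]: "(\<lambda>\<omega>. \<lambda>i\<in>{..<n}. X i \<omega>) \<in> measurable M (Pi\<^sub>M {..<n} (\<lambda>_. borel))"
    "(\<lambda>\<omega>. \<lambda>i\<in>{..<n}. X (\<pi> i) \<omega>) \<in> measurable M (Pi\<^sub>M {..<n} (\<lambda>_. borel))"
    by (intro measurable_restrict; simp)+
  have "(\<integral>x. F x \<partial>distr M (Pi\<^sub>M {..<n} (\<lambda>_. borel)) (\<lambda>\<omega>. \<lambda>i\<in>{..<n}. X (\<pi> i) \<omega>))
      = (\<integral>x. F x \<partial>distr M (Pi\<^sub>M {..<n} (\<lambda>_. borel)) (\<lambda>\<omega>. \<lambda>i\<in>{..<n}. X i \<omega>))"
    using assms(1,3) unfolding exchangeable_def by simp
  then show ?thesis by (subst (asm) (1 2) integral_distr) auto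
qed

text \<open>Subtracting a constant acts coordinatewise in the same way, hence commutes with
  permutations. This gives Spitzer's identity at every level \<open>a\<close>.\<close>

lemma exchangeable_diff_const:
  assumes "exchangeable M n X" "\<And>i. i < n \<Longrightarrow> X i \<in> borel_measurable M"
  shows "exchangeable M n (\<lambda>i \<omega>. X i \<omega> - a)"
  unfolding exchangeable_def
proof (intro allI impI)
  fix \<pi> assume \<pi>: "\<pi> permutes {..<n}"
  have [measurable]: "i < n \<Longrightarrow> X i \<in> borel_measurable M" "i < n \<Longrightarrow> X (\<pi> i) \<in> borel_measurable M" for i
    using assms(2) permutes_in_image[OF \<pi>, of i] by auto
  let ?P = "Pi\<^sub>M {..<n} (\<lambda>_. borel :: real measure)"
  define h where "h = (\<lambda>(x :: nat \<Rightarrow> real). \<lambda>i\<in>{..<n}. x i - a)"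
  have h: "h \<in> measurable ?P ?P"
    unfolding h_def by (intro measurable_restrict) measurable
  have m: "(\<lambda>\<omega>. \<lambda>i\<in>{..<n}. X i \<omega>) \<in> measurable M ?P" "(\<lambda>\<omega>. \<lambda>i\<in>{..<n}. X (\<pi> i) \<omega>) \<in> measurable M ?P"
    by (intro measurable_restrict; simp)+
  have "distr M ?P (\<lambda>\<omega>. \<lambda>i\<in>{..<n}. X (\<pi> i) \<omega> - a) = distr (distr M ?P (\<lambda>\<omega>. \<lambda>i\<in>{..<n}. X (\<pi> i) \<omega>)) ?P h"
    unfolding distr_distr[OF h m(2)] by (intro distr_cong) (auto simp: h_def)
  also have "distr M ?P (\<lambda>\<omega>. \<lambda>i\<in>{..<n}. X (\<pi> i) \<omega>) = distr M ?P (\<lambda>\<omega>. \<lambda>i\<in>{..<n}. X i \<omega>)"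
    using assms(1) \<pi> unfolding exchangeable_def by blast
  also have "distr (distr M ?P (\<lambda>\<omega>. \<lambda>i\<in>{..<n}. X i \<omega>)) ?P h = distr M ?P (\<lambda>\<omega>. \<lambda>i\<in>{..<n}. X i \<omega> - a)"
    unfolding distr_distr[OF h m(1)] by (intro distr_cong) (auto simp: h_def)
  finally show "distr M ?P (\<lambda>\<omega>. \<lambda>i\<in>{..<n}. X (\<pi> i) \<omega> - a) = distr M ?P (\<lambda>\<omega>. \<lambda>i\<in>{..<n}. X i \<omega> - a)" .
qed

text \<open>A cycle on the indices up to \<open>m\<close>, fixing all others: it shifts the first
  \<open>m\<close> entries by one and preserves the sum of the first m + 1.\<close>

lemma rotation_permutes:
  assumes "m < n"
  shows "(\<lambda>i. if i < m then Suc i else if i = m then 0 else i) permutes {..<n}"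
proof (rule bij_imp_permutes)
  let ?\<pi> = "\<lambda>i. if i < m then Suc i else if i = m then 0 else i"
  have "inj_on ?\<pi> {..<n}" by (auto simp: inj_on_def split: if_splits)
  moreover have "?\<pi> ` {..<n} \<subseteq> {..<n}" using assms by auto
  ultimately show "bij_betw ?\<pi> {..<n} {..<n}"
    unfolding bij_betw_def using endo_inj_surj by blast
qed (use assms in auto)

lemma integrable_psum:
  "(\<And>i. i < k \<Longrightarrow> integrable M (X i)) \<Longrightarrow> integrable M (\<lambda>\<omega>. psum (\<lambda>i. X i \<omega>) k)"
  unfolding psum_def by (intro Bochner_Integration.integrable_sum) auto

lemma integrable_max_psum:
  "(\<And>i. i < m \<Longrightarrow> integrable M (X i)) \<Longrightarrow> integrable M (\<lambda>\<omega>. max_psum m (\<lambda>i. X i \<omega>))"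
proof (induction m)
  case (Suc m)
  then show ?case unfolding max_psum_Suc by (intro integrable_max integrable_psum) auto
qed simp

text \<open>On \<open>S\<^bsub>m+1\<^esub> > 0\<close> the maximum is \<open>X\<^sub>0\<close> plus the maximum for the shifted sequence, which a rotation of
  the first \<open>m + 1\<close> variables turns into the unshifted one; on the complement the last sum is irrelevant.\<close>

lemma spitzer_step:
  fixes X :: "nat \<Rightarrow> 'a \<Rightarrow> real"
  assumes ex: "exchangeable M n X" and int: "\<And>i. i < n \<Longrightarrow> integrable M (X i)" and m: "m < n"
  shows "(\<integral>\<omega>. max_psum (Suc m) (\<lambda>i. X i \<omega>) \<partial>M) =
    (\<integral>\<omega>. max_psum m (\<lambda>i. X i \<omega>) \<partial>M) + (\<integral>\<omega>. max 0 (psum (\<lambda>i. X i \<omega>) (Suc m)) \<partial>M) / real (Suc m)"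
proof -
  have meas[measurable]: "X i \<in> borel_measurable M" if "i < n" for i using int[OF that] by auto
  define S where "S \<omega> = psum (\<lambda>i. X i \<omega>) (Suc m)" for \<omega>
  have intS: "integrable M S" unfolding S_def using m int by (intro integrable_psum) auto
  have [measurable]: "S \<in> borel_measurable M" using intS by auto
  define A where "A \<omega> = (if 0 < S \<omega> then 1 else 0 :: real)" for \<omega>
  have [measurable]: "A \<in> borel_measurable M" unfolding A_def by measurable
  have intA: "integrable M (\<lambda>\<omega>. A \<omega> * Z \<omega>)" if "integrable M Z" for Z
    using that by (intro Bochner_Integration.integrable_bound[OF that]) (auto simp: A_def)
  have int_max: "integrable M (\<lambda>\<omega>. max_psum m (\<lambda>i. X i \<omega>))"
    "integrable M (\<lambda>\<omega>. max_psum m (\<lambda>i. X (Suc i) \<omega>))"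
    using m by (auto intro!: integrable_max_psum[of m M X] integrable_max_psum[of m M "\<lambda>i. X (Suc i)"] int)
  have [measurable]: "(\<lambda>x. x 0) \<in> borel_measurable (Pi\<^sub>M {..<n} (\<lambda>_. borel :: real measure))"
    "(\<lambda>x. psum x (Suc m)) \<in> borel_measurable (Pi\<^sub>M {..<n} (\<lambda>_. borel))"
    "max_psum m \<in> borel_measurable (Pi\<^sub>M {..<n} (\<lambda>_. borel))"
    using m by (auto intro!: measurable_component_singleton measurable_psum_PiM measurable_max_psum_PiM)
  \<comment> \<open>Swapping 0 and \<open>i\<close> leaves the sum of the first m + 1 variables, and
    hence \<open>A\<close>, unchanged. The m + 1 equal integrals add up to the mean of the positive
    part of that sum, which is the source of the factor 1/(m + 1).\<close>
  have first: "(\<integral>\<omega>. A \<omega> * X i \<omega> \<partial>M) = (\<integral>\<omega>. A \<omega> * X 0 \<omega> \<partial>M)" if "i < Suc m" for i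
  proof -
    define \<pi> where "\<pi> = Transposition.transpose 0 i"
    have \<pi>: "\<pi> permutes {..<n}" "\<pi> permutes {..<Suc m}"
      using that m unfolding \<pi>_def by (auto intro!: permutes_swap_id)
    define F where "F x = (if 0 < psum x (Suc m) then 1 else 0) * x 0" for x :: "nat \<Rightarrow> real"
    have F: "F \<in> borel_measurable (Pi\<^sub>M {..<n} (\<lambda>_. borel))"
      unfolding F_def by measurable
    have "F (\<lambda>j\<in>{..<n}. X (\<pi> j) \<omega>) = A \<omega> * X i \<omega>" for \<omega>
      using m by (simp add: F_def A_def S_def psum_restrict psum_permute[OF \<pi>(2), of "\<lambda>j. X j \<omega>"])
        (simp add: \<pi>_def)
    moreover have "F (\<lambda>j\<in>{..<n}. X j \<omega>) = A \<omega> * X 0 \<omega>" for \<omega>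
      using m by (simp add: F_def A_def S_def psum_restrict)
    ultimately show ?thesis using exchangeable_integral[OF ex meas \<pi>(1) F] by simp
  qed
  have "(\<integral>\<omega>. max 0 (S \<omega>) \<partial>M) = (\<integral>\<omega>. (\<Sum>i<Suc m. A \<omega> * X i \<omega>) \<partial>M)"
    by (intro Bochner_Integration.integral_cong)
      (auto simp: A_def S_def psum_def max_def simp del: sum.lessThan_Suc simp flip: sum_distrib_left)
  also have "\<dots> = (\<Sum>i<Suc m. (\<integral>\<omega>. A \<omega> * X i \<omega> \<partial>M))"
    using m int by (intro Bochner_Integration.integral_sum intA) auto
  also have "\<dots> = (\<Sum>i<Suc m. (\<integral>\<omega>. A \<omega> * X 0 \<omega> \<partial>M))"
    by (intro sum.cong refl first) auto
  finally have 1: "(\<integral>\<omega>. A \<omega> * X 0 \<omega> \<partial>M) = (\<integral>\<omega>. max 0 (S \<omega>) \<partial>M) / real (Suc m)"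
    by (simp add: field_simps del: sum.lessThan_Suc)
  have 2: "(\<integral>\<omega>. A \<omega> * max_psum m (\<lambda>i. X (Suc i) \<omega>) \<partial>M) = (\<integral>\<omega>. A \<omega> * max_psum m (\<lambda>i. X i \<omega>) \<partial>M)"
  proof -
    define \<pi> where "\<pi> i = (if i < m then Suc i else if i = m then 0 else i)" for i
    have \<pi>: "\<pi> permutes {..<n}" "\<pi> permutes {..<Suc m}"
      using rotation_permutes[OF m] rotation_permutes[of m "Suc m"] unfolding \<pi>_def by auto
    define F where "F x = (if 0 < psum x (Suc m) then 1 else 0) * max_psum m x" for x :: "nat \<Rightarrow> real"
    have F: "F \<in> borel_measurable (Pi\<^sub>M {..<n} (\<lambda>_. borel))"
      unfolding F_def by measurable
    have "max_psum m (\<lambda>j\<in>{..<n}. X (\<pi> j) \<omega>) = max_psum m (\<lambda>i. X (Suc i) \<omega>)"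
      "max_psum m (\<lambda>j\<in>{..<n}. X j \<omega>) = max_psum m (\<lambda>i. X i \<omega>)" for \<omega>
      using m by (auto intro!: max_psum_cong simp: \<pi>_def)
    then have "F (\<lambda>j\<in>{..<n}. X (\<pi> j) \<omega>) = A \<omega> * max_psum m (\<lambda>i. X (Suc i) \<omega>)"
      "F (\<lambda>j\<in>{..<n}. X j \<omega>) = A \<omega> * max_psum m (\<lambda>i. X i \<omega>)" for \<omega>
      using m by (simp_all add: F_def A_def S_def psum_restrict psum_permute[OF \<pi>(2), of "\<lambda>j. X j \<omega>"])
    then show ?thesis using exchangeable_integral[OF ex meas \<pi>(1) F] by simp
  qed
  have "(\<integral>\<omega>. max_psum (Suc m) (\<lambda>i. X i \<omega>) \<partial>M) =
    (\<integral>\<omega>. A \<omega> * X 0 \<omega> + A \<omega> * max_psum m (\<lambda>i. X (Suc i) \<omega>)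
      + (max_psum m (\<lambda>i. X i \<omega>) - A \<omega> * max_psum m (\<lambda>i. X i \<omega>)) \<partial>M)"
    by (intro Bochner_Integration.integral_cong) (auto simp: max_psum_Suc_cases A_def S_def)
  also have "\<dots> = (\<integral>\<omega>. A \<omega> * X 0 \<omega> \<partial>M) + (\<integral>\<omega>. A \<omega> * max_psum m (\<lambda>i. X (Suc i) \<omega>) \<partial>M)
      + ((\<integral>\<omega>. max_psum m (\<lambda>i. X i \<omega>) \<partial>M) - (\<integral>\<omega>. A \<omega> * max_psum m (\<lambda>i. X i \<omega>) \<partial>M))"
    using m int int_max intA by simp
  finally show ?thesis unfolding 1 2 S_def by simp
qed

lemma spitzer:
  assumes "exchangeable M n X" "\<And>i. i < n \<Longrightarrow> integrable M (X i)" "m \<le> n"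
  shows "(\<integral>\<omega>. max_psum m (\<lambda>i. X i \<omega>) \<partial>M)
    = (\<Sum>k=1..m. (\<integral>\<omega>. max 0 (psum (\<lambda>i. X i \<omega>) k) \<partial>M) / real k)"
  using assms(3)
proof (induction m)
  case (Suc m)
  then show ?case using spitzer_step[OF assms(1,2), of m] by simp
qed simp

section \<open>Second moments by integration over levels\<close>

text \<open>The integrand vanishes beyond a = x/k, and up to there -(x - a k)^2/k^2 is an
  antiderivative. The case k = 1 serves the slopes, general \<open>k\<close> the partial
  sums.\<close>

lemma nn_integral_pos_part_linear:
  assumes "1 \<le> (k::nat)"
  shows "(\<integral>\<^sup>+a. ennreal (2 * (max 0 (x - a * real k) / real k)) * indicator {0..} a \<partial>lborel)
    = ennreal ((max 0 x)\<^sup>2 / (real k)\<^sup>2)"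
proof (cases "0 \<le> x")
  case True
  have "(\<integral>\<^sup>+a. ennreal (2 * (max 0 (x - a * real k) / real k)) * indicator {0..} a \<partial>lborel)
      = (\<integral>\<^sup>+a. ennreal (2 * ((x - a * real k) / real k)) * indicator {0..x / real k} a \<partial>lborel)"
  proof (intro nn_integral_cong)
    fix a :: real
    show "ennreal (2 * (max 0 (x - a * real k) / real k)) * indicator {0..} a
      = ennreal (2 * ((x - a * real k) / real k)) * indicator {0..x / real k} a"
      using assms by (auto simp: indicator_def max_def divide_simps)
  qed
  also have "\<dots> = ennreal (- ((x - x / real k * real k)\<^sup>2 / (real k)\<^sup>2) - (- ((x - 0 * real k)\<^sup>2 / (real k)\<^sup>2)))"
    using assms True
    by (intro nn_integral_FTC_Icc[where F="\<lambda>a. - ((x - a * real k)\<^sup>2 / (real k)\<^sup>2)"])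
      (auto intro!: derivative_eq_intros simp: field_simps power2_eq_square)
  finally show ?thesis using True assms by (simp add: max_def)
next
  case False
  have "(\<integral>\<^sup>+a. ennreal (2 * (max 0 (x - a * real k) / real k)) * indicator {0..} a \<partial>lborel)
      = (\<integral>\<^sup>+a. 0 \<partial>(lborel :: real measure))"
  proof (intro nn_integral_cong)
    fix a :: real
    have "x - a * real k \<le> 0" if "0 \<le> a" using False that mult_nonneg_nonneg[of a "real k"] by linarith
    then show "ennreal (2 * (max 0 (x - a * real k) / real k)) * indicator {0..} a = 0"
      by (auto simp: indicator_def max_def)
  qed
  then show ?thesis using False by (simp add: max_def)
qed

text \<open>Tonelli's theorem exchanges level and probability. One statement covers both sides of
  the moment identity: \<open>d\<close> is constantly 1 for the slopes and d k = k for the sums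
  S_k.\<close>

lemma (in prob_space) nn_integral_square_pos_part:
  fixes f :: "'i \<Rightarrow> 'a \<Rightarrow> real" and d :: "'i \<Rightarrow> nat"
  assumes "finite J" and [measurable]: "\<And>j. j \<in> J \<Longrightarrow> f j \<in> borel_measurable M" and d: "\<And>j. j \<in> J \<Longrightarrow> 1 \<le> d j"
  shows "(\<Sum>j\<in>J. \<integral>\<^sup>+\<omega>. ennreal ((max 0 (f j \<omega>))\<^sup>2 / (real (d j))\<^sup>2) \<partial>M)
    = (\<integral>\<^sup>+a. 2 * (\<Sum>j\<in>J. \<integral>\<^sup>+\<omega>. ennreal (max 0 (f j \<omega> - a * real (d j)) / real (d j)) \<partial>M) * indicator {0..} a \<partial>lborel)"
proof -
  interpret P: pair_sigma_finite M "lborel :: real measure" ..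
  have "(\<Sum>j\<in>J. \<integral>\<^sup>+\<omega>. ennreal ((max 0 (f j \<omega>))\<^sup>2 / (real (d j))\<^sup>2) \<partial>M) =
    (\<Sum>j\<in>J. \<integral>\<^sup>+\<omega>. (\<integral>\<^sup>+a. ennreal (2 * (max 0 (f j \<omega> - a * real (d j)) / real (d j))) * indicator {0..} a \<partial>lborel) \<partial>M)"
    using d by (intro sum.cong refl nn_integral_cong nn_integral_pos_part_linear[symmetric])
  also have "\<dots> = (\<Sum>j\<in>J. \<integral>\<^sup>+a. (\<integral>\<^sup>+\<omega>. ennreal (2 * (max 0 (f j \<omega> - a * real (d j)) / real (d j))) * indicator {0..} a \<partial>M) \<partial>lborel)"
    by (intro sum.cong refl P.Fubini'[symmetric]) measurable
  also have "\<dots> = (\<integral>\<^sup>+a. (\<Sum>j\<in>J. \<integral>\<^sup>+\<omega>. ennreal (2 * (max 0 (f j \<omega> - a * real (d j)) / real (d j))) * indicator {0..} a \<partial>M) \<partial>lborel)"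
    by (intro nn_integral_sum[symmetric]) measurable
  also have "\<dots> = (\<integral>\<^sup>+a. 2 * (\<Sum>j\<in>J. \<integral>\<^sup>+\<omega>. ennreal (max 0 (f j \<omega> - a * real (d j)) / real (d j)) \<partial>M) * indicator {0..} a \<partial>lborel)"
  proof (intro nn_integral_cong)
    fix a :: real
    have "(\<integral>\<^sup>+\<omega>. ennreal (2 * (max 0 (f j \<omega> - a * real (d j)) / real (d j))) * indicator {0..} a \<partial>M)
      = 2 * (\<integral>\<^sup>+\<omega>. ennreal (max 0 (f j \<omega> - a * real (d j)) / real (d j)) \<partial>M) * indicator {0..} a"
      if j: "j \<in> J" for j
    proof -
      have [measurable]: "f j \<in> borel_measurable M" using j by measurable
      have "(\<integral>\<^sup>+\<omega>. ennreal (2 * (max 0 (f j \<omega> - a * real (d j)) / real (d j))) * indicator {0..} a \<partial>M)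
        = (\<integral>\<^sup>+\<omega>. 2 * ennreal (max 0 (f j \<omega> - a * real (d j)) / real (d j)) * indicator {0..} a \<partial>M)"
        by (simp only: ennreal_mult[of 2] ennreal_numeral zero_le_numeral divide_nonneg_nonneg of_nat_0_le_iff max.cobounded1)
      then show ?thesis by (simp add: nn_integral_cmult nn_integral_multc)
    qed
    then show "(\<Sum>j\<in>J. \<integral>\<^sup>+\<omega>. ennreal (2 * (max 0 (f j \<omega> - a * real (d j)) / real (d j))) * indicator {0..} a \<partial>M)
      = 2 * (\<Sum>j\<in>J. \<integral>\<^sup>+\<omega>. ennreal (max 0 (f j \<omega> - a * real (d j)) / real (d j)) \<partial>M) * indicator {0..} a"
      by (simp add: sum_distrib_left sum_distrib_right)
  qed
  finally show ?thesis .
qed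

text \<open>\<open>a < g\<^sub>j\<close> holds iff for some rational \<open>q > a\<close> a sum \<open>S\<^sub>k - q k\<close> with \<open>k > j\<close> exceeds all those with \<open>k \<le> j\<close>.\<close>

lemma measurable_majorant_slope:
  assumes [measurable]: "\<And>k. k \<le> n \<Longrightarrow> (\<lambda>\<omega>. S \<omega> k) \<in> borel_measurable M" and j: "j < n"
  shows "(\<lambda>\<omega>. majorant_slope c n (S \<omega>) j) \<in> borel_measurable M"
  unfolding borel_measurable_iff_greater
proof
  fix a :: real
  define P where "P q \<omega> \<longleftrightarrow> (\<exists>k\<in>{Suc j..n}. \<forall>i\<in>{..j}. S \<omega> i - q * real i < S \<omega> k - q * real k)" for q \<omega>
  have eq: "{\<omega> \<in> space M. a < majorant_slope c n (S \<omega>) j} = (\<Union>q\<in>{q \<in> \<rat>. a < q}. {\<omega> \<in> space M. P q \<omega>})"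
  proof safe
    fix \<omega> assume "\<omega> \<in> space M" "a < majorant_slope c n (S \<omega>) j"
    then obtain q where "q \<in> \<rat>" "a < q" "q < majorant_slope c n (S \<omega>) j"
      using Rats_dense_in_real by blast
    then show "\<omega> \<in> (\<Union>q\<in>{q \<in> \<rat>. a < q}. {\<omega> \<in> space M. P q \<omega>})"
      using less_majorant_slopeD[OF j, of q c "S \<omega>"] \<open>\<omega> \<in> space M\<close> by (force simp: P_def)
  next
    fix \<omega> and q :: real assume "a < q" "P q \<omega>"
    then have "q \<le> majorant_slope c n (S \<omega>) j"
      using le_majorant_slopeI[OF j, of _ "S \<omega>" q c] by (auto simp: P_def)
    with \<open>a < q\<close> show "a < majorant_slope c n (S \<omega>) j" by simp
  qed
  have P: "{\<omega> \<in> space M. P q \<omega>} \<in> sets M" for q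
  proof -
    have "{\<omega> \<in> space M. S \<omega> i - q * real i < S \<omega> k - q * real k} \<in> sets M" if "i \<le> n" "k \<le> n" for i k
      using that by measurable
    then show ?thesis unfolding P_def using j
      by (intro sets.sets_Collect_finite_Ex sets.sets_Collect_finite_All) auto
  qed
  have "countable {q \<in> \<rat>. a < q}" using countable_rat by (rule countable_subset[rotated]) auto
  then show "{\<omega> \<in> space M. a < majorant_slope c n (S \<omega>) j} \<in> sets M"
    unfolding eq using P by (intro sets.countable_UN') auto
qed

text \<open>Square integrability of the slopes is an outcome: the comparison runs through
  nonnegative integrals, and the side with the partial sums is finite by hypothesis.\<close>

lemma (in prob_space) exchangeable_majorant_slope_moment:
  fixes X :: "nat \<Rightarrow> 'a \<Rightarrow> real" and c :: real
  assumes ex: "exchangeable M n X" and int: "\<And>i. i < n \<Longrightarrow> integrable M (X i)"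
    and mean: "\<And>i. i < n \<Longrightarrow> expectation (X i) = 0"
    and square: "\<And>k. k \<le> n \<Longrightarrow> integrable M (\<lambda>\<omega>. (psum (\<lambda>i. X i \<omega>) k)\<^sup>2)"
  defines "g \<equiv> \<lambda>j \<omega>. majorant_slope c n (psum (\<lambda>i. X i \<omega>)) j"
  shows "\<And>j. j < n \<Longrightarrow> integrable M (\<lambda>\<omega>. (g j \<omega>)\<^sup>2)"
    and "(\<Sum>j<n. expectation (\<lambda>\<omega>. (g j \<omega>)\<^sup>2)) = (\<Sum>k=1..n. expectation (\<lambda>\<omega>. (psum (\<lambda>i. X i \<omega>) k)\<^sup>2) / (real k)\<^sup>2)"
proof -
  define S where "S k \<omega> = psum (\<lambda>i. X i \<omega>) k" for k \<omega>
  have intS: "integrable M (S k)" if "k \<le> n" for k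
    unfolding S_def using that int by (intro integrable_psum) auto
  then have [measurable]: "S k \<in> borel_measurable M" if "k \<le> n" for k
    using that by auto
  have meanS: "expectation (S k) = 0" if "k \<le> n" for k
    unfolding S_def psum_def using that int mean by (subst Bochner_Integration.integral_sum) auto
  have [measurable]: "g j \<in> borel_measurable M" if "j < n" for j
    unfolding g_def using that by (intro measurable_majorant_slope) (auto simp flip: S_def)
  have meas_X: "X i \<in> borel_measurable M" if "i < n" for i
    using int[OF that] by auto
  define Mx where "Mx a \<omega> = max_psum n (\<lambda>i. X i \<omega> - a)" for a \<omega>
  have Mx_nonneg: "0 \<le> Mx a \<omega>" for a \<omega>
    unfolding Mx_def by (rule max_psum_nonneg)
  have sum_pos: "(\<Sum>j<n. max 0 (g j \<omega> - a)) = Mx a \<omega>" for a \<omega>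
    unfolding g_def sum_pos_part_majorant_slope Mx_def max_psum_def psum_diff_const by simp
  have sum_g: "(\<Sum>j<n. g j \<omega>) = S n \<omega>" for \<omega>
    unfolding g_def S_def using sum_majorant_slope[of c n "psum (\<lambda>i. X i \<omega>)"] by simp
  have int_Mx: "integrable M (Mx a)" for a
    unfolding Mx_def using int by (intro integrable_max_psum) auto
  have int_pos: "integrable M (\<lambda>\<omega>. max 0 (S k \<omega> - a))" if "k \<le> n" for k a
    using intS[OF that] by (intro integrable_max) auto
  have E_Mx: "expectation (Mx a) = (\<Sum>k=1..n. expectation (\<lambda>\<omega>. max 0 (S k \<omega> - a * real k)) / real k)" for a
    unfolding Mx_def S_def psum_diff_const[symmetric]
    using exchangeable_diff_const[OF ex meas_X] int by (intro spitzer) auto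
  \<comment> \<open>The identity (-x - a)^+ = (x + a)^+ - (x + a) is summed over the slopes, whose
    total is S_n.\<close>
  have sum_neg: "(\<Sum>j<n. max 0 (- g j \<omega> - a)) = Mx (- a) \<omega> - (S n \<omega> + real n * a)" for a \<omega>
  proof -
    have "max 0 (- x - a) = max 0 (x - (- a)) - (x + a)" for x by (simp add: max_def)
    then have "(\<Sum>j<n. max 0 (- g j \<omega> - a)) = (\<Sum>j<n. max 0 (g j \<omega> - (- a))) - ((\<Sum>j<n. g j \<omega>) + real n * a)"
      by (simp add: sum_subtractf sum.distrib)
    then show ?thesis unfolding sum_pos sum_g .
  qed
  \<comment> \<open>The same identity for each S_k, divided by \<open>k\<close>, costs
    \<open>a\<close> in the mean because S_k is centred. The \<open>n\<close> terms together match
    the correction n a on the side of the slopes.\<close>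
  have E_neg: "expectation (\<lambda>\<omega>. Mx (- a) \<omega> - (S n \<omega> + real n * a))
    = (\<Sum>k=1..n. expectation (\<lambda>\<omega>. max 0 (- S k \<omega> - a * real k)) / real k)" for a
  proof -
    have "expectation (\<lambda>\<omega>. max 0 (- S k \<omega> - a * real k)) / real k
      = expectation (\<lambda>\<omega>. max 0 (S k \<omega> - (- a) * real k)) / real k - a" if k: "k \<in> {1..n}" for k
    proof -
      have "max 0 (- x - a * real k) = max 0 (x - (- a * real k)) - (x + a * real k)" for x
        by (simp add: max_def)
      then have "expectation (\<lambda>\<omega>. max 0 (- S k \<omega> - a * real k))
        = expectation (\<lambda>\<omega>. max 0 (S k \<omega> - (- a * real k)) - (S k \<omega> + a * real k))" by simp
      also have "\<dots> = expectation (\<lambda>\<omega>. max 0 (S k \<omega> - (- a * real k))) - (expectation (S k) + a * real k)"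
        using k int_pos[of k "- a * real k"] intS[of k]
        by (subst Bochner_Integration.integral_diff) (auto simp: prob_space)
      finally show ?thesis using k meanS[of k] by (simp add: diff_divide_distrib)
    qed
    then have "(\<Sum>k=1..n. expectation (\<lambda>\<omega>. max 0 (- S k \<omega> - a * real k)) / real k)
      = expectation (Mx (- a)) - real n * a"
      unfolding E_Mx by (simp add: sum_subtractf)
    also have "\<dots> = expectation (\<lambda>\<omega>. Mx (- a) \<omega> - (S n \<omega> + real n * a))"
      using int_Mx intS[of n] meanS[of n] by (simp add: prob_space)
    finally show ?thesis by simp
  qed
  have nn_S: "ennreal (\<Sum>k=1..n. expectation (\<lambda>\<omega>. max 0 (u * S k \<omega> - a * real k)) / real k)
    = (\<Sum>k=1..n. \<integral>\<^sup>+\<omega>. ennreal (max 0 (u * S k \<omega> - a * real k) / real k) \<partial>M)" for a u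
  proof -
    have "ennreal (expectation (\<lambda>\<omega>. max 0 (u * S k \<omega> - a * real k)) / real k)
      = (\<integral>\<^sup>+\<omega>. ennreal (max 0 (u * S k \<omega> - a * real k) / real k) \<partial>M)" if "k \<in> {1..n}" for k
    proof -
      have "integrable M (\<lambda>\<omega>. max 0 (u * S k \<omega> - a * real k) / real k)"
        using that intS[of k] by (intro integrable_divide integrable_max) auto
      from nn_integral_eq_integral[OF this] show ?thesis by simp
    qed
    then show ?thesis by (subst sum_ennreal[symmetric]) (auto intro!: divide_nonneg_nonneg Bochner_Integration.integral_nonneg)
  qed
  have nn_pos: "(\<Sum>j<n. \<integral>\<^sup>+\<omega>. ennreal (max 0 (g j \<omega> - a)) \<partial>M)
    = (\<Sum>k=1..n. \<integral>\<^sup>+\<omega>. ennreal (max 0 (S k \<omega> - a * real k) / real k) \<partial>M)" for a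
  proof -
    have "(\<Sum>j<n. \<integral>\<^sup>+\<omega>. ennreal (max 0 (g j \<omega> - a)) \<partial>M) = (\<integral>\<^sup>+\<omega>. (\<Sum>j<n. ennreal (max 0 (g j \<omega> - a))) \<partial>M)"
      by (intro nn_integral_sum[symmetric]) measurable
    also have "\<dots> = (\<integral>\<^sup>+\<omega>. ennreal (Mx a \<omega>) \<partial>M)"
      by (subst sum_ennreal) (auto simp: sum_pos)
    also have "\<dots> = ennreal (expectation (Mx a))"
      using int_Mx Mx_nonneg by (intro nn_integral_eq_integral) auto
    also have "\<dots> = (\<Sum>k=1..n. \<integral>\<^sup>+\<omega>. ennreal (max 0 (S k \<omega> - a * real k) / real k) \<partial>M)"
      unfolding E_Mx using nn_S[of 1 a] by (simp only: mult_1)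
    finally show ?thesis .
  qed
  have nn_neg: "(\<Sum>j<n. \<integral>\<^sup>+\<omega>. ennreal (max 0 (- g j \<omega> - a)) \<partial>M)
    = (\<Sum>k=1..n. \<integral>\<^sup>+\<omega>. ennreal (max 0 (- S k \<omega> - a * real k) / real k) \<partial>M)" for a
  proof -
    have "(\<Sum>j<n. \<integral>\<^sup>+\<omega>. ennreal (max 0 (- g j \<omega> - a)) \<partial>M) = (\<integral>\<^sup>+\<omega>. (\<Sum>j<n. ennreal (max 0 (- g j \<omega> - a))) \<partial>M)"
      by (intro nn_integral_sum[symmetric]) measurable
    also have "\<dots> = (\<integral>\<^sup>+\<omega>. ennreal (Mx (- a) \<omega> - (S n \<omega> + real n * a)) \<partial>M)"
      by (subst sum_ennreal) (auto simp: sum_neg)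
    also have "\<dots> = ennreal (expectation (\<lambda>\<omega>. Mx (- a) \<omega> - (S n \<omega> + real n * a)))"
    proof (intro nn_integral_eq_integral AE_I2)
      show "0 \<le> Mx (- a) \<omega> - (S n \<omega> + real n * a)" for \<omega>
        unfolding sum_neg[symmetric] by (intro sum_nonneg) auto
    qed (use int_Mx intS in auto)
    also have "\<dots> = (\<Sum>k=1..n. \<integral>\<^sup>+\<omega>. ennreal (max 0 (- S k \<omega> - a * real k) / real k) \<partial>M)"
      unfolding E_neg using nn_S[of "-1" a] by (simp only: mult_minus1)
    finally show ?thesis .
  qed
  have split_square: "(\<integral>\<^sup>+\<omega>. ennreal ((f \<omega>)\<^sup>2 / (real d)\<^sup>2) \<partial>M) =
      (\<integral>\<^sup>+\<omega>. ennreal ((max 0 (f \<omega>))\<^sup>2 / (real d)\<^sup>2) \<partial>M) + (\<integral>\<^sup>+\<omega>. ennreal ((max 0 (- f \<omega>))\<^sup>2 / (real d)\<^sup>2) \<partial>M)"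
    if [measurable]: "f \<in> borel_measurable M" for f and d :: nat
  proof -
    have eq: "ennreal (x\<^sup>2 / (real d)\<^sup>2) = ennreal ((max 0 x)\<^sup>2 / (real d)\<^sup>2) + ennreal ((max 0 (- x))\<^sup>2 / (real d)\<^sup>2)" for x
    proof -
      have "x\<^sup>2 = (max 0 x)\<^sup>2 + (max 0 (- x))\<^sup>2" by (cases "0 \<le> x") (simp_all add: max_absorb1 max_absorb2)
      then have "x\<^sup>2 / (real d)\<^sup>2 = (max 0 x)\<^sup>2 / (real d)\<^sup>2 + (max 0 (- x))\<^sup>2 / (real d)\<^sup>2"
        by (metis add_divide_distrib)
      then show ?thesis by (simp only: ennreal_plus zero_le_divide_iff zero_le_power2 simp_thms)
    qed
    show ?thesis
      by (subst nn_integral_add[symmetric]) (auto intro!: nn_integral_cong eq)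
  qed
  have transfer: "(\<Sum>j<n. \<integral>\<^sup>+\<omega>. ennreal ((max 0 (h j \<omega>))\<^sup>2 / (real 1)\<^sup>2) \<partial>M)
      = (\<Sum>k=1..n. \<integral>\<^sup>+\<omega>. ennreal ((max 0 (T k \<omega>))\<^sup>2 / (real k)\<^sup>2) \<partial>M)"
    if "\<And>a. (\<Sum>j<n. \<integral>\<^sup>+\<omega>. ennreal (max 0 (h j \<omega> - a)) \<partial>M)
        = (\<Sum>k=1..n. \<integral>\<^sup>+\<omega>. ennreal (max 0 (T k \<omega> - a * real k) / real k) \<partial>M)"
      and [measurable]: "\<And>j. j < n \<Longrightarrow> h j \<in> borel_measurable M"
        "\<And>k. k \<le> n \<Longrightarrow> T k \<in> borel_measurable M"
    for h T :: "nat \<Rightarrow> 'a \<Rightarrow> real"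
  proof -
    have "(\<Sum>j<n. \<integral>\<^sup>+\<omega>. ennreal ((max 0 (h j \<omega>))\<^sup>2 / (real 1)\<^sup>2) \<partial>M)
      = (\<integral>\<^sup>+a. 2 * (\<Sum>j<n. \<integral>\<^sup>+\<omega>. ennreal (max 0 (h j \<omega> - a * real 1) / real 1) \<partial>M) * indicator {0..} a \<partial>lborel)"
      by (rule nn_integral_square_pos_part) auto
    also have "\<dots> = (\<integral>\<^sup>+a. 2 * (\<Sum>k=1..n. \<integral>\<^sup>+\<omega>. ennreal (max 0 (T k \<omega> - a * real k) / real k) \<partial>M)
        * indicator {0..} a \<partial>lborel)"
      by (simp only: of_nat_1 mult_1_right div_by_1 that(1))
    also have "\<dots> = (\<Sum>k=1..n. \<integral>\<^sup>+\<omega>. ennreal ((max 0 (T k \<omega>))\<^sup>2 / (real k)\<^sup>2) \<partial>M)"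
      by (rule nn_integral_square_pos_part[symmetric]) auto
    finally show ?thesis .
  qed
  have "(\<Sum>j<n. \<integral>\<^sup>+\<omega>. ennreal ((g j \<omega>)\<^sup>2 / (real 1)\<^sup>2) \<partial>M) =
    (\<Sum>j<n. \<integral>\<^sup>+\<omega>. ennreal ((max 0 (g j \<omega>))\<^sup>2 / (real 1)\<^sup>2) \<partial>M)
    + (\<Sum>j<n. \<integral>\<^sup>+\<omega>. ennreal ((max 0 (- g j \<omega>))\<^sup>2 / (real 1)\<^sup>2) \<partial>M)"
    unfolding sum.distrib[symmetric] by (intro sum.cong refl split_square) measurable
  also have "(\<Sum>j<n. \<integral>\<^sup>+\<omega>. ennreal ((max 0 (g j \<omega>))\<^sup>2 / (real 1)\<^sup>2) \<partial>M)
    = (\<Sum>k=1..n. \<integral>\<^sup>+\<omega>. ennreal ((max 0 (S k \<omega>))\<^sup>2 / (real k)\<^sup>2) \<partial>M)"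
    by (intro transfer nn_pos) auto
  also have "(\<Sum>j<n. \<integral>\<^sup>+\<omega>. ennreal ((max 0 (- g j \<omega>))\<^sup>2 / (real 1)\<^sup>2) \<partial>M)
    = (\<Sum>k=1..n. \<integral>\<^sup>+\<omega>. ennreal ((max 0 (- S k \<omega>))\<^sup>2 / (real k)\<^sup>2) \<partial>M)"
    by (intro transfer nn_neg) auto
  also have "(\<Sum>k=1..n. \<integral>\<^sup>+\<omega>. ennreal ((max 0 (S k \<omega>))\<^sup>2 / (real k)\<^sup>2) \<partial>M)
      + (\<Sum>k=1..n. \<integral>\<^sup>+\<omega>. ennreal ((max 0 (- S k \<omega>))\<^sup>2 / (real k)\<^sup>2) \<partial>M)
    = (\<Sum>k=1..n. \<integral>\<^sup>+\<omega>. ennreal ((S k \<omega>)\<^sup>2 / (real k)\<^sup>2) \<partial>M)"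
    unfolding sum.distrib[symmetric] by (intro sum.cong refl split_square[symmetric]) auto
  also have "\<dots> = (\<Sum>k=1..n. ennreal (expectation (\<lambda>\<omega>. (S k \<omega>)\<^sup>2) / (real k)\<^sup>2))"
  proof (intro sum.cong refl)
    fix k assume "k \<in> {1..n}"
    then have "integrable M (\<lambda>\<omega>. (S k \<omega>)\<^sup>2 / (real k)\<^sup>2)"
      using square[of k] by (simp add: S_def)
    from nn_integral_eq_integral[OF this]
    show "(\<integral>\<^sup>+\<omega>. ennreal ((S k \<omega>)\<^sup>2 / (real k)\<^sup>2) \<partial>M) = ennreal (expectation (\<lambda>\<omega>. (S k \<omega>)\<^sup>2) / (real k)\<^sup>2)"
      by simp
  qed
  also have "\<dots> = ennreal (\<Sum>k=1..n. expectation (\<lambda>\<omega>. (S k \<omega>)\<^sup>2) / (real k)\<^sup>2)"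
    by (intro sum_ennreal) auto
  finally have *: "(\<Sum>j<n. \<integral>\<^sup>+\<omega>. ennreal ((g j \<omega>)\<^sup>2) \<partial>M)
    = ennreal (\<Sum>k=1..n. expectation (\<lambda>\<omega>. (S k \<omega>)\<^sup>2) / (real k)\<^sup>2)" by simp
  show int_g: "integrable M (\<lambda>\<omega>. (g j \<omega>)\<^sup>2)" if j: "j < n" for j
  proof (rule integrableI_bounded)
    have "(\<integral>\<^sup>+\<omega>. ennreal ((g j \<omega>)\<^sup>2) \<partial>M) \<le> (\<Sum>j<n. \<integral>\<^sup>+\<omega>. ennreal ((g j \<omega>)\<^sup>2) \<partial>M)"
      using j by (intro member_le_sum) auto
    then show "(\<integral>\<^sup>+\<omega>. ennreal (norm ((g j \<omega>)\<^sup>2)) \<partial>M) < \<infinity>"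
      unfolding * by (simp add: le_less_trans)
  qed (use j in measurable)
  have "ennreal (\<Sum>j<n. expectation (\<lambda>\<omega>. (g j \<omega>)\<^sup>2)) = (\<Sum>j<n. \<integral>\<^sup>+\<omega>. ennreal ((g j \<omega>)\<^sup>2) \<partial>M)"
    using int_g by (subst sum_ennreal[symmetric]) (auto simp: nn_integral_eq_integral)
  then have "(\<Sum>j<n. expectation (\<lambda>\<omega>. (g j \<omega>)\<^sup>2)) = (\<Sum>k=1..n. expectation (\<lambda>\<omega>. (S k \<omega>)\<^sup>2) / (real k)\<^sup>2)"
    unfolding * by (subst (asm) ennreal_inj) (auto intro!: sum_nonneg)
  then show "(\<Sum>j<n. expectation (\<lambda>\<omega>. (g j \<omega>)\<^sup>2))
      = (\<Sum>k=1..n. expectation (\<lambda>\<omega>. (psum (\<lambda>i. X i \<omega>) k)\<^sup>2) / (real k)\<^sup>2)"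
    unfolding S_def .
qed

section \<open>Exchangeable blocks of a Gaussian process\<close>

lemma normal_law_moments:
  assumes "0 \<le> \<sigma>"
  shows "sets (normal_law m \<sigma>) = sets borel"
    and "integrable (normal_law m \<sigma>) (\<lambda>x. x)" "(\<integral>x. x \<partial>normal_law m \<sigma>) = m"
    and "integrable (normal_law m \<sigma>) (\<lambda>x. (x - m)\<^sup>2)" "(\<integral>x. (x - m)\<^sup>2 \<partial>normal_law m \<sigma>) = \<sigma>\<^sup>2"
proof -
  have "sets (normal_law m \<sigma>) = sets borel \<and> integrable (normal_law m \<sigma>) (\<lambda>x. x) \<and> (\<integral>x. x \<partial>normal_law m \<sigma>) = m
    \<and> integrable (normal_law m \<sigma>) (\<lambda>x. (x - m)\<^sup>2) \<and> (\<integral>x. (x - m)\<^sup>2 \<partial>normal_law m \<sigma>) = \<sigma>\<^sup>2"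
  proof (cases "\<sigma> = 0")
    case True
    then have law: "normal_law m \<sigma> = return borel m" by (simp add: normal_law_def)
    have int: "integrable (return borel m) f" if "f \<in> borel_measurable borel" for f :: "real \<Rightarrow> real"
      using that by (intro integrableI_bounded) (auto simp: nn_integral_return)
    show ?thesis unfolding law using True by (intro conjI int) (simp_all add: integral_return)
  next
    case False
    then have \<sigma>: "0 < \<sigma>" using assms by simp
    have law: "normal_law m \<sigma> = density lborel (\<lambda>x. ennreal (normal_density m \<sigma> x))"
      using False by (simp add: normal_law_def)
    show ?thesis unfolding law
      using integrable_normal_moment_nz_1[OF \<sigma>, of m] integral_normal_moment_nz_1[OF \<sigma>, of m]
        integrable_normal_moment[OF \<sigma>, of m 2] integral_normal_moment_even[OF \<sigma>, of m 1]
      by (simp add: integrable_density integral_density)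
  qed
  then show "sets (normal_law m \<sigma>) = sets borel"
    "integrable (normal_law m \<sigma>) (\<lambda>x. x)" "(\<integral>x. x \<partial>normal_law m \<sigma>) = m"
    "integrable (normal_law m \<sigma>) (\<lambda>x. (x - m)\<^sup>2)" "(\<integral>x. (x - m)\<^sup>2 \<partial>normal_law m \<sigma>) = \<sigma>\<^sup>2"
    by auto
qed

lemma normal_law_if_distr:
  assumes [measurable]: "Z \<in> borel_measurable M" and "0 \<le> \<sigma>" and law: "distr M borel Z = normal_law m \<sigma>"
  shows "integrable M Z" "(\<integral>\<omega>. Z \<omega> \<partial>M) = m" "integrable M (\<lambda>\<omega>. (Z \<omega> - m)\<^sup>2)"
    "(\<integral>\<omega>. (Z \<omega> - m)\<^sup>2 \<partial>M) = \<sigma>\<^sup>2"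
  using normal_law_moments[OF assms(2), of m] unfolding law[symmetric]
  by (simp_all add: integrable_distr_eq integral_distr)

locale centered_gaussian = prob_space M for M :: "'a measure" +
  fixes Y :: "nat \<Rightarrow> 'a \<Rightarrow> real" and K :: "nat \<Rightarrow> nat \<Rightarrow> real"
  assumes gaussian: "gaussian_process M Y"
    and mean: "expectation (Y x) = 0"
    and cov: "covariance M (Y x) (Y x') = K x x'"
begin

lemma measurable_Y [measurable]: "Y x \<in> borel_measurable M"
  using gaussian unfolding gaussian_process_def by blast

lemma distr_sum_normal_law:
  assumes "finite F"
  obtains m \<sigma> where "0 \<le> \<sigma>" "distr M borel (\<lambda>\<omega>. \<Sum>x\<in>F. a x * Y x \<omega>) = normal_law m \<sigma>"
proof -
  have "\<forall>F a. finite F \<longrightarrow> (\<exists>m \<sigma>. 0 \<le> \<sigma> \<and> distr M borel (\<lambda>\<omega>. \<Sum>x\<in>F. a x * Y x \<omega>) = normal_law m \<sigma>)"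
    using gaussian unfolding gaussian_process_def by (rule conjunct2)
  from this[rule_format, OF assms, of a] show ?thesis using that by auto
qed

lemma integrable_Y: "integrable M (Y x)"
  and integrable_Y_square: "integrable M (\<lambda>\<omega>. (Y x \<omega>)\<^sup>2)"
proof -
  obtain m \<sigma> where "0 \<le> \<sigma>" "distr M borel (\<lambda>\<omega>. \<Sum>x\<in>{x}. 1 * Y x \<omega>) = normal_law m \<sigma>"
    by (rule distr_sum_normal_law[of "{x}" "\<lambda>_. 1"]) auto
  then have *: "0 \<le> \<sigma>" "distr M borel (Y x) = normal_law m \<sigma>" by simp_all
  from normal_law_if_distr[OF measurable_Y *] mean[of x] show "integrable M (Y x)" "integrable M (\<lambda>\<omega>. (Y x \<omega>)\<^sup>2)"
    by auto
qed

lemma integrable_Y_mult: "integrable M (\<lambda>\<omega>. Y x \<omega> * Y x' \<omega>)"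
proof (rule Bochner_Integration.integrable_bound)
  show "integrable M (\<lambda>\<omega>. (Y x \<omega>)\<^sup>2 + (Y x' \<omega>)\<^sup>2)"
    by (intro Bochner_Integration.integrable_add integrable_Y_square)
  have "\<bar>a * b\<bar> \<le> a\<^sup>2 + b\<^sup>2" for a b :: real
    using sum_squares_bound[of "\<bar>a\<bar>" "\<bar>b\<bar>"] mult_nonneg_nonneg[of "\<bar>a\<bar>" "\<bar>b\<bar>"]
    unfolding abs_mult power2_abs by linarith
  then show "AE \<omega> in M. norm (Y x \<omega> * Y x' \<omega>) \<le> norm ((Y x \<omega>)\<^sup>2 + (Y x' \<omega>)\<^sup>2)"
    by (auto simp: abs_of_nonneg)
qed measurable

lemma expectation_Y_mult: "expectation (\<lambda>\<omega>. Y x \<omega> * Y x' \<omega>) = K x x'"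
  using cov[of x x'] mean unfolding covariance_def by simp

lemma combination_square_eq:
  "(\<Sum>i\<in>J. t i * Y (f i) \<omega>)\<^sup>2 = (\<Sum>i\<in>J. \<Sum>j\<in>J. t i * t j * (Y (f i) \<omega> * Y (f j) \<omega>))"
  unfolding power2_eq_square sum_product by (intro sum.cong refl) (simp add: mult_ac)

lemma integrable_combination_square: "integrable M (\<lambda>\<omega>. (\<Sum>i\<in>J. t i * Y (f i) \<omega>)\<^sup>2)"
  unfolding combination_square_eq
  by (intro Bochner_Integration.integrable_sum integrable_mult_right integrable_Y_mult)

lemma expectation_combination_square:
  "expectation (\<lambda>\<omega>. (\<Sum>i\<in>J. t i * Y (f i) \<omega>)\<^sup>2) = (\<Sum>i\<in>J. \<Sum>j\<in>J. t i * t j * K (f i) (f j))"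
proof -
  have "expectation (\<lambda>\<omega>. \<Sum>i\<in>J. \<Sum>j\<in>J. t i * t j * (Y (f i) \<omega> * Y (f j) \<omega>))
      = (\<Sum>i\<in>J. expectation (\<lambda>\<omega>. \<Sum>j\<in>J. t i * t j * (Y (f i) \<omega> * Y (f j) \<omega>)))"
    by (intro Bochner_Integration.integral_sum Bochner_Integration.integrable_sum integrable_mult_right integrable_Y_mult)
  also have "\<dots> = (\<Sum>i\<in>J. \<Sum>j\<in>J. expectation (\<lambda>\<omega>. t i * t j * (Y (f i) \<omega> * Y (f j) \<omega>)))"
    by (intro sum.cong refl Bochner_Integration.integral_sum integrable_mult_right integrable_Y_mult)
  finally show ?thesis unfolding combination_square_eq by (simp add: expectation_Y_mult)
qed

text \<open>A normal law is determined by its mean and variance, so the law of a linear combination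
  depends on the kernel alone, whether or not it degenerates.\<close>

lemma distr_combination:
  assumes "finite J" "inj_on f J"
  shows "distr M borel (\<lambda>\<omega>. \<Sum>i\<in>J. t i * Y (f i) \<omega>)
    = normal_law 0 (sqrt (\<Sum>i\<in>J. \<Sum>j\<in>J. t i * t j * K (f i) (f j)))"
proof -
  define Z where "Z \<omega> = (\<Sum>i\<in>J. t i * Y (f i) \<omega>)" for \<omega>
  have [measurable]: "Z \<in> borel_measurable M" unfolding Z_def by measurable
  \<comment> \<open>The Gaussian property speaks of coefficients attached to points of the index
    set, so the combination is rewritten over the image of \<open>f\<close>.\<close>
  have "(\<Sum>x\<in>f ` J. t (inv_into J f x) * Y x \<omega>) = Z \<omega>" for \<omega>
    using assms by (simp add: sum.reindex Z_def)
  moreover obtain m \<sigma> where "0 \<le> \<sigma>"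
    "distr M borel (\<lambda>\<omega>. \<Sum>x\<in>f ` J. t (inv_into J f x) * Y x \<omega>) = normal_law m \<sigma>"
    using distr_sum_normal_law[OF finite_imageI[OF assms(1)]] .
  ultimately have *: "0 \<le> \<sigma>" "distr M borel Z = normal_law m \<sigma>" by simp_all
  note Z = normal_law_if_distr[OF _ *]
  have "expectation Z = 0"
    unfolding Z_def by (subst Bochner_Integration.integral_sum) (auto simp: integrable_Y mean)
  then have m: "m = 0" using Z(2) by simp
  then have "\<sigma>\<^sup>2 = (\<Sum>i\<in>J. \<Sum>j\<in>J. t i * t j * K (f i) (f j))"
    using Z(4) expectation_combination_square[where t=t and f=f and J=J] by (simp add: Z_def)
  then have "\<sigma> = sqrt (\<Sum>i\<in>J. \<Sum>j\<in>J. t i * t j * K (f i) (f j))"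
    using *(1) by (metis real_sqrt_unique)
  then show ?thesis using *(2) m unfolding Z_def by simp
qed

text \<open>A matrix with one value on the diagonal and another off it is unchanged by simultaneous
  permutation of rows and columns. All linear combinations keep their laws, and the Cramer-Wold
  device gives the joint law.\<close>

lemma exchangeable_block:
  assumes K: "\<And>i j. i < n \<Longrightarrow> j < n \<Longrightarrow> K (r + i) (r + j) = (if i = j then v else u)"
  shows "exchangeable M n (\<lambda>i. Y (r + i))"
  unfolding exchangeable_def
proof (intro allI impI cramer_wold)
  fix \<pi> :: "nat \<Rightarrow> nat" and t :: "nat \<Rightarrow> real" assume \<pi>: "\<pi> permutes {..<n}"
  have inj: "inj_on (\<lambda>i. r + \<pi> i) {..<n}" "inj_on (\<lambda>i. r + i) {..<n}"
    using permutes_inj[OF \<pi>] by (auto simp: inj_on_def dest: injD)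
  have "K (r + \<pi> i) (r + \<pi> j) = K (r + i) (r + j)" if "i < n" "j < n" for i j
    using K[OF that] K[of "\<pi> i" "\<pi> j"] permutes_in_image[OF \<pi>] that injD[OF permutes_inj[OF \<pi>], of i j] by auto
  then show "distr M borel (\<lambda>\<omega>. \<Sum>i<n. t i * Y (r + \<pi> i) \<omega>) = distr M borel (\<lambda>\<omega>. \<Sum>i<n. t i * Y (r + i) \<omega>)"
    unfolding distr_combination[OF finite_lessThan inj(1)] distr_combination[OF finite_lessThan inj(2)]
    by (auto intro!: arg_cong[where f="normal_law 0"] sum.cong)
qed (auto intro: prob_space_axioms)

lemma expectation_psum_square:
  assumes K: "\<And>i j. i < n \<Longrightarrow> j < n \<Longrightarrow> K (r + i) (r + j) = (if i = j then v else u)" and k: "k \<le> n"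
  shows "expectation (\<lambda>\<omega>. (psum (\<lambda>i. Y (r + i) \<omega>) k)\<^sup>2) = real k * (v - u) + (real k)\<^sup>2 * u"
proof -
  have "expectation (\<lambda>\<omega>. (psum (\<lambda>i. Y (r + i) \<omega>) k)\<^sup>2) = (\<Sum>i<k. \<Sum>j<k. K (r + i) (r + j))"
    using expectation_combination_square[where J="{..<k}" and t="\<lambda>_. 1" and f="\<lambda>i. r + i"]
    by (simp only: psum_def mult_1)
  also have "\<dots> = (\<Sum>i<k. \<Sum>j<k. (if i = j then v - u else 0) + u)"
    using k by (intro sum.cong refl) (auto simp: K)
  also have "\<dots> = real k * (v - u) + (real k)\<^sup>2 * u"
    by (simp add: sum.distrib power2_eq_square algebra_simps)
  finally show ?thesis .
qed

lemma gren_block_moment: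
  assumes K: "\<And>i j. i < n \<Longrightarrow> j < n \<Longrightarrow> K (r + i) (r + j) = (if i = j then v else u)"
  shows "j < n \<Longrightarrow> integrable M (\<lambda>\<omega>. (gren r (r + n - 1) (\<lambda>z. Y z \<omega>) (r + j))\<^sup>2)"
    and "(\<Sum>j<n. expectation (\<lambda>\<omega>. (gren r (r + n - 1) (\<lambda>z. Y z \<omega>) (r + j))\<^sup>2))
      = (\<Sum>k=1..n. (v - u) / real k + u)"
proof -
  have sq: "integrable M (\<lambda>\<omega>. (psum (\<lambda>i. Y (r + i) \<omega>) k)\<^sup>2)" for k
    using integrable_combination_square[where J="{..<k}" and t="\<lambda>_. 1" and f="\<lambda>i. r + i"]
    by (simp only: psum_def mult_1)
  have "exchangeable M n (\<lambda>i. Y (r + i))"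
    by (rule exchangeable_block, rule K)
  note moment = exchangeable_majorant_slope_moment[OF this integrable_Y mean sq, where c="real r - 1"]
  show "j < n \<Longrightarrow> integrable M (\<lambda>\<omega>. (gren r (r + n - 1) (\<lambda>z. Y z \<omega>) (r + j))\<^sup>2)"
    using moment(1)[of j] gren_eq_majorant_slope[of j n] by simp
  have "(\<Sum>j<n. expectation (\<lambda>\<omega>. (gren r (r + n - 1) (\<lambda>z. Y z \<omega>) (r + j))\<^sup>2))
    = (\<Sum>j<n. expectation (\<lambda>\<omega>. (majorant_slope (real r - 1) n (psum (\<lambda>i. Y (r + i) \<omega>)) j)\<^sup>2))"
    by (intro sum.cong refl) (simp only: gren_eq_majorant_slope lessThan_iff)
  also have "\<dots> = (\<Sum>k=1..n. expectation (\<lambda>\<omega>. (psum (\<lambda>i. Y (r + i) \<omega>) k)\<^sup>2) / (real k)\<^sup>2)"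
    by (rule moment(2))
  also have "\<dots> = (\<Sum>k=1..n. (v - u) / real k + u)"
  proof (intro sum.cong refl)
    fix k assume k: "k \<in> {1..n}"
    have "expectation (\<lambda>\<omega>. (psum (\<lambda>i. Y (r + i) \<omega>) k)\<^sup>2) = real k * (v - u) + (real k)\<^sup>2 * u"
    proof (rule expectation_psum_square)
      show "k \<le> n" using k by simp
    qed (rule K)
    then show "expectation (\<lambda>\<omega>. (psum (\<lambda>i. Y (r + i) \<omega>) k)\<^sup>2) / (real k)\<^sup>2 = (v - u) / real k + u"
      using k by (simp add: add_divide_distrib power2_eq_square)
  qed
  finally show "(\<Sum>j<n. expectation (\<lambda>\<omega>. (gren r (r + n - 1) (\<lambda>z. Y z \<omega>) (r + j))\<^sup>2))
      = (\<Sum>k=1..n. (v - u) / real k + u)" .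
qed

end

section \<open>Level sets of a decreasing probability mass function\<close>

text \<open>\<open>p\<close> is constant on the union of two overlapping stretches, so the strict
  jumps at the ends of one prevent the other from reaching further. Using this in both orders gives
  equality.\<close>

lemma flat_stretch_subset:
  assumes "flat_stretch p r s" "x \<in> {r..s}" "flat_stretch p r' s'" "x \<in> {r'..s'}"
  shows "r \<le> r'" "s' \<le> s"
proof -
  have const: "p y = p x" if "y \<in> {r..s} \<or> y \<in> {r'..s'}" for y
  proof -
    have 1: "p z = p r" if "z \<in> {r..s}" for z using assms(1) that unfolding flat_stretch_def by blast
    have 2: "p z = p r'" if "z \<in> {r'..s'}" for z using assms(3) that unfolding flat_stretch_def by blast
    show ?thesis using that 1[of y] 2[of y] 1[OF assms(2)] 2[OF assms(4)] by auto
  qed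
  show "r \<le> r'"
  proof (rule ccontr)
    assume "\<not> r \<le> r'"
    then have "p (r - 1) = p x" "p r = p x" "r \<noteq> 0" using assms(2,4) by (auto intro!: const)
    moreover have "r = 0 \<or> p (r - 1) > p r" using assms(1) unfolding flat_stretch_def by blast
    ultimately show False by simp
  qed
  show "s' \<le> s"
  proof (rule ccontr)
    assume "\<not> s' \<le> s"
    then have "p (s + 1) = p x" "p s = p x" using assms(2,4) by (auto intro!: const)
    moreover have "p s > p (s + 1)" using assms(1) unfolding flat_stretch_def by blast
    ultimately show False by simp
  qed
qed

lemma gren_on_stretches_flat:
  assumes "flat_stretch p r s" "x \<in> {r..s}"
  shows "gren_on_stretches p y x = gren r s y x"
proof -
  have "(THE (r, s). flat_stretch p r s \<and> x \<in> {r..s}) = (r, s)"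
  proof (rule the_equality)
    fix rs :: "nat \<times> nat"
    assume *: "case rs of (r, s) \<Rightarrow> flat_stretch p r s \<and> x \<in> {r..s}"
    obtain r' s' where rs: "rs = (r', s')" by (cases rs)
    have "flat_stretch p r' s'" "x \<in> {r'..s'}" using * unfolding rs by auto
    from flat_stretch_subset[OF assms this] flat_stretch_subset[OF this assms] show "rs = (r, s)"
      unfolding rs by auto
  qed (use assms in auto)
  moreover have "\<exists>r s. flat_stretch p r s \<and> x \<in> {r..s}" using assms by blast
  ultimately show ?thesis unfolding gren_on_stretches_def by simp
qed

lemma gren_on_stretches_not_flat:
  assumes "\<And>r s. flat_stretch p r s \<Longrightarrow> x \<notin> {r..s}"
  shows "gren_on_stretches p y x = y x"
  using assms unfolding gren_on_stretches_def by auto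

text \<open>A level set with at least two points is a flat stretch, with v = \<theta> - \<theta>^2
  and u = -\<theta>^2 in the block formula. A singleton is not a stretch, as these require r < s;
  there the process is unchanged and its variance \<theta>(1 - \<theta>) is the same formula for n =
  1.\<close>

lemma (in centered_gaussian) gren_on_level_set_moment:
  fixes p :: "nat \<Rightarrow> real" and \<theta> :: real
  assumes K: "\<And>x x'. K x x' = p x * (if x = x' then 1 else 0) - p x * p x'"
    and dec: "antimono p" and level: "{x. p x = \<theta>} = {r..<r + n}" and n: "1 \<le> n"
  shows "x \<in> {r..<r + n} \<Longrightarrow> integrable M (\<lambda>\<omega>. (gren_on_stretches p (\<lambda>z. Y z \<omega>) x)\<^sup>2)"
    and "(\<Sum>x\<in>{r..<r + n}. expectation (\<lambda>\<omega>. (gren_on_stretches p (\<lambda>z. Y z \<omega>) x)\<^sup>2)) = (\<Sum>j=1..n. \<theta> * (1 / real j - \<theta>))"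
proof -
  have p: "p y = \<theta> \<longleftrightarrow> y \<in> {r..<r + n}" for y using level by blast
  have "(x \<in> {r..<r + n} \<longrightarrow> integrable M (\<lambda>\<omega>. (gren_on_stretches p (\<lambda>z. Y z \<omega>) x)\<^sup>2)) \<and>
    (\<Sum>x\<in>{r..<r + n}. expectation (\<lambda>\<omega>. (gren_on_stretches p (\<lambda>z. Y z \<omega>) x)\<^sup>2)) = (\<Sum>j=1..n. \<theta> * (1 / real j - \<theta>))"
  proof (cases "n = 1")
    case True
    have "r \<notin> {r'..s'}" if "flat_stretch p r' s'" for r' s'
    proof
      assume r: "r \<in> {r'..s'}"
      have "p y = \<theta>" if "y \<in> {r'..s'}" for y
        using \<open>flat_stretch p r' s'\<close> r that p[of r] True unfolding flat_stretch_def
        by (metis atLeastLessThan_iff le_refl less_add_one)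
      then have "p r' = \<theta>" "p s' = \<theta>" using r by auto
      then show False using that p[of r'] p[of s'] True by (simp add: flat_stretch_def)
    qed
    then have "gren_on_stretches p y r = y r" for y by (intro gren_on_stretches_not_flat) auto
    moreover have "expectation (\<lambda>\<omega>. (Y r \<omega>)\<^sup>2) = \<theta> * (1 - \<theta>)"
      using expectation_Y_mult[of r r] K[of r r] p[of r] True by (simp add: power2_eq_square algebra_simps)
    ultimately show ?thesis using True integrable_Y_square by auto
  next
    case False
    have flat: "flat_stretch p r (r + n - 1)"
      unfolding flat_stretch_def
    proof (intro conjI ballI)
      show "r < r + n - 1" using n False by simp
      have "p (r + n - 1) = \<theta>" "p (r + n) \<noteq> \<theta>" "p r = \<theta>" using n p by auto
      moreover have "p (r + n) \<le> p (r + n - 1)" by (intro antimonoD[OF dec]) simp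
      ultimately show "p (r + n - 1 + 1) < p (r + n - 1)" using n by simp
      have "p (r - 1) \<noteq> \<theta>" if "r \<noteq> 0" using that p by auto
      moreover have "p r \<le> p (r - 1)" by (intro antimonoD[OF dec]) simp
      ultimately show "r = 0 \<or> p r < p (r - 1)" using \<open>p r = \<theta>\<close> by fastforce
      show "p x = p r" if "x \<in> {r..r + n - 1}" for x
      proof -
        have "p x = \<theta>" using that n p[of x] by auto
        then show ?thesis using \<open>p r = \<theta>\<close> by simp
      qed
    qed
    have gren: "gren_on_stretches p y (r + j) = gren r (r + n - 1) y (r + j)" if "j < n" for y j
      using that by (intro gren_on_stretches_flat[OF flat]) auto
    have "K (r + i) (r + j) = (if i = j then \<theta> - \<theta> * \<theta> else - (\<theta> * \<theta>))" if "i < n" "j < n" for i j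
      using that K p[of "r + i"] p[of "r + j"] by simp
    note moment = gren_block_moment[OF this, of n]
    have "(\<Sum>x\<in>{r..<r + n}. expectation (\<lambda>\<omega>. (gren_on_stretches p (\<lambda>z. Y z \<omega>) x)\<^sup>2))
      = (\<Sum>j<n. expectation (\<lambda>\<omega>. (gren_on_stretches p (\<lambda>z. Y z \<omega>) (r + j))\<^sup>2))"
      using sum.shift_bounds_nat_ivl[of _ 0 r n] by (simp add: atLeast0LessThan add.commute)
    also have "\<dots> = (\<Sum>j<n. expectation (\<lambda>\<omega>. (gren r (r + n - 1) (\<lambda>z. Y z \<omega>) (r + j))\<^sup>2))"
      by (intro sum.cong refl) (simp add: gren)
    also have "\<dots> = (\<Sum>k=1..n. (\<theta> - \<theta> * \<theta> - - (\<theta> * \<theta>)) / real k + - (\<theta> * \<theta>))"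
      by (intro moment(2)) auto
    also have "\<dots> = (\<Sum>k=1..n. \<theta> * (1 / real k - \<theta>))"
      by (intro sum.cong refl) (simp add: algebra_simps)
    finally have "(\<Sum>x\<in>{r..<r + n}. expectation (\<lambda>\<omega>. (gren_on_stretches p (\<lambda>z. Y z \<omega>) x)\<^sup>2))
      = (\<Sum>k=1..n. \<theta> * (1 / real k - \<theta>))" .
    moreover have "integrable M (\<lambda>\<omega>. (gren_on_stretches p (\<lambda>z. Y z \<omega>) x)\<^sup>2)" if "x \<in> {r..<r + n}"
    proof -
      from that obtain j where j: "x = r + j" "j < n" by (metis atLeastLessThan_iff le_Suc_ex nat_add_left_cancel_less)
      show ?thesis unfolding j(1) gren[OF j(2)] using j(2) by (intro moment(1)) auto
    qed
    ultimately show ?thesis by blast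
  qed
  then show "x \<in> {r..<r + n} \<Longrightarrow> integrable M (\<lambda>\<omega>. (gren_on_stretches p (\<lambda>z. Y z \<omega>) x)\<^sup>2)"
    "(\<Sum>x\<in>{r..<r + n}. expectation (\<lambda>\<omega>. (gren_on_stretches p (\<lambda>z. Y z \<omega>) x)\<^sup>2)) = (\<Sum>j=1..n. \<theta> * (1 / real j - \<theta>))"
    by blast+
qed

lemma antimono_level_set_interval:
  fixes p :: "nat \<Rightarrow> real"
  assumes "antimono p" "finite {x. p x = t}" "{x. p x = t} \<noteq> {}"
  obtains r n where "1 \<le> n" "{x. p x = t} = {r..<r + n}"
proof -
  define r s where "r = Min {x. p x = t}" and "s = Max {x. p x = t}"
  have rs: "p r = t" "p s = t" "r \<le> s" "\<And>x. p x = t \<Longrightarrow> r \<le> x \<and> x \<le> s"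
    using Min_in[OF assms(2,3)] Max_in[OF assms(2,3)] assms(2) Min_le Max_ge unfolding r_def s_def by auto
  have mid: "p x = t" if "r \<le> x" "x \<le> s" for x
    using antimonoD[OF assms(1) that(1)] antimonoD[OF assms(1) that(2)] rs(1,2) by simp
  have "{x. p x = t} = {r..s}"
  proof (intro set_eqI iffI)
    fix x assume "x \<in> {x. p x = t}"
    then have "p x = t" by (rule CollectD)
    from rs(4)[OF this] show "x \<in> {r..s}" by simp
  next
    fix x assume "x \<in> {r..s}"
    then show "x \<in> {x. p x = t}" by (intro CollectI mid) auto
  qed
  also have "\<dots> = {r..<r + (Suc s - r)}" using rs(3) by auto
  finally show ?thesis using that[of "Suc s - r" r] rs(3) by simp
qed

section \<open>Summation over all level sets\<close>

lemma sum_pmf_le_1: "finite F \<Longrightarrow> (\<Sum>x\<in>F. pmf p x) \<le> 1"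
  by (simp flip: measure_measure_pmf_finite)

lemma finite_pmf_level_set:
  assumes "0 < t"
  shows "finite {x. pmf p x = t}"
proof (rule ccontr)
  assume "infinite {x. pmf p x = t}"
  obtain n where n: "1 / t < real n" using reals_Archimedean2 by blast
  obtain B where B: "finite B" "card B = n" "B \<subseteq> {x. pmf p x = t}"
    using infinite_arbitrarily_large[OF \<open>infinite {x. pmf p x = t}\<close>] by blast
  have "real n * t = (\<Sum>x\<in>B. pmf p x)"
    using B by (simp add: subset_eq)
  also have "\<dots> \<le> 1" using B(1) by (rule sum_pmf_le_1)
  finally show False using n assms by (simp add: field_simps)
qed

text \<open>A disjoint union is a bijective image of the dependent sum of its parts, where unordered
  sums may be evaluated fibre by fibre.\<close>

lemma has_sum_UN_finite:
  fixes f :: "'b \<Rightarrow> real"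
  assumes "f summable_on (\<Union>i\<in>I. C i)" "disjoint_family_on C I" "\<And>i. i \<in> I \<Longrightarrow> finite (C i)"
  shows "((\<lambda>i. \<Sum>x\<in>C i. f x) has_sum infsum f (\<Union>i\<in>I. C i)) I"
proof -
  have snd: "snd ` Sigma I C = (\<Union>i\<in>I. C i)" by force
  have inj: "inj_on snd (Sigma I C)"
    using assms(2) by (force simp: disjoint_family_on_def inj_on_def)
  have "(f has_sum infsum f (\<Union>i\<in>I. C i)) (snd ` Sigma I C)"
    unfolding snd using assms(1) by (rule has_sum_infsum)
  then have "(f \<circ> snd has_sum infsum f (\<Union>i\<in>I. C i)) (Sigma I C)"
    using has_sum_reindex[OF inj] by blast
  then show ?thesis
    by (rule has_sum_SigmaD) (auto intro!: has_sum_finite assms(3))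
qed

text \<open>The index set is an initial segment of the positive integers, finite or not according to
  \<open>N\<close>, so every index between two of its members belongs to it and the one-step
  inequalities chain.\<close>

lemma theta_strict_antimono:
  fixes \<theta> :: "nat \<Rightarrow> real" and N :: enat
  assumes "I = {i. 1 \<le> i \<and> enat i \<le> N}"
    and step: "\<And>i. i \<in> I \<Longrightarrow> i + 1 \<in> I \<Longrightarrow> \<theta> (i + 1) < \<theta> i"
    and "i \<in> I" "j \<in> I" "i < j"
  shows "\<theta> j < \<theta> i"
proof -
  have down: "k \<in> I" if "k \<le> j" "1 \<le> k" for k
    using that assms(1,4) order_trans[of "enat k" "enat j" N] by auto
  have "Suc i \<le> j" using assms(5) by simp
  then show ?thesis
    using assms(4) down
  proof (induction j rule: dec_induct)
    case base
    then show ?case using step[of i] assms(3) by simp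
  next
    case (step k)
    have "k \<in> I" using step.prems(2)[of k] step.hyps by simp
    moreover have "\<theta> (k + 1) < \<theta> k"
      using \<open>k \<in> I\<close> step.prems(1) assms(2)[of k] by simp
    ultimately show ?case using step.IH step.prems(2) by fastforce
  qed
qed

theorem proposition4p5:
  fixes M :: "'a measure"
    and p :: "nat pmf"
    and Y YG :: "nat \<Rightarrow> 'a \<Rightarrow> real"
    and N :: enat
    and I :: "nat set"
    and C :: "nat \<Rightarrow> nat set"
    and \<theta> :: "nat \<Rightarrow> real"
  assumes "prob_space M"
    and decreasing: "\<And>x. pmf p x \<ge> pmf p (x + 1)"
    and index_set: "I = {i. 1 \<le> i \<and> enat i \<le> N}"
    and theta_pos: "\<And>i. i \<in> I \<Longrightarrow> \<theta> i > 0"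
    and theta_decreasing: "\<And>i. i \<in> I \<Longrightarrow> i + 1 \<in> I \<Longrightarrow> \<theta> i > \<theta> (i + 1)"
    and nonempty: "\<And>i. i \<in> I \<Longrightarrow> C i \<noteq> {}"
    and disjoint: "disjoint_family_on C I"
    and cover: "(\<Union>i\<in>I. C i) = {x. pmf p x > 0}"
    and constant_on: "\<And>i x. i \<in> I \<Longrightarrow> x \<in> C i \<Longrightarrow> pmf p x = \<theta> i"
    and Y: "centered_gaussian_process_l2 M Y
              (\<lambda>x x'. pmf p x * (if x = x' then 1 else 0) - pmf p x * pmf p x')"
    and YG: "\<And>x \<omega>. YG x \<omega> = gren_on_stretches (pmf p) (\<lambda>z. Y z \<omega>) x"
  shows
    "((AE \<omega> in M. summable (\<lambda>x. (YG x \<omega>)\<^sup>2)) \<and>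
      integrable M (\<lambda>\<omega>. \<Sum>x. (YG x \<omega>)\<^sup>2) \<and>
      (\<lambda>i. \<Sum>j=1..card (C i). \<theta> i * (1 / real j - \<theta> i)) summable_on I \<and>
      (\<integral>\<omega>. (\<Sum>x. (YG x \<omega>)\<^sup>2) \<partial>M)
        = (\<Sum>\<^sub>\<infinity>i\<in>I. \<Sum>j=1..card (C i). \<theta> i * (1 / real j - \<theta> i)))
     \<and>
     (bdd_above {x. pmf p x > 0} \<longrightarrow>
       (let \<kappa> = Sup {x. pmf p x > 0} in
         integrable M (\<lambda>\<omega>. \<Sum>x=0..\<kappa>. (YG x \<omega>)\<^sup>2 / pmf p x) \<and>
         (\<lambda>i. \<Sum>j=1..card (C i). 1 / real j - \<theta> i) summable_on I \<and>
         (\<integral>\<omega>. (\<Sum>x=0..\<kappa>. (YG x \<omega>)\<^sup>2 / pmf p x) \<partial>M)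
           = (\<Sum>\<^sub>\<infinity>i\<in>I. \<Sum>j=1..card (C i). 1 / real j - \<theta> i)))"
proof -
  interpret centered_gaussian M Y "\<lambda>x x'. pmf p x * (if x = x' then 1 else 0) - pmf p x * pmf p x'"
  proof (intro centered_gaussian.intro centered_gaussian_axioms.intro)
    note * = Y[unfolded centered_gaussian_process_l2_def]
    show "prob_space M" by fact
    show "gaussian_process M Y" using * by (rule conjunct1)
    show "(\<integral>\<omega>. Y x \<omega> \<partial>M) = 0" for x
      by (rule *[THEN conjunct2, THEN conjunct2, THEN conjunct1, rule_format])
    show "covariance M (Y x) (Y x') = pmf p x * (if x = x' then 1 else 0) - pmf p x * pmf p x'" for x x'
      by (rule *[THEN conjunct2, THEN conjunct2, THEN conjunct2, rule_format])
  qed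
  have dec: "antimono (pmf p)"
    using decreasing unfolding antimono_iff_le_Suc by simp
  have theta_less: "\<theta> j < \<theta> i" if "i \<in> I" "j \<in> I" "i < j" for i j
    using index_set theta_decreasing that by (rule theta_strict_antimono[where \<theta>=\<theta>])
  \<comment> \<open>Each part is a full level set because distinct indices carry distinct values of
    \<theta>.\<close>
  have C_eq: "C i = {x. pmf p x = \<theta> i}" if i: "i \<in> I" for i
  proof (intro equalityI subsetI CollectI)
    fix x assume "x \<in> {x. pmf p x = \<theta> i}"
    then have x: "pmf p x = \<theta> i" by simp
    then have "x \<in> (\<Union>i\<in>I. C i)" using theta_pos[OF i] cover by simp
    then obtain j where j: "j \<in> I" "x \<in> C j" by blast
    then have "\<theta> j = \<theta> i" using constant_on x by simp
    then have "j = i" using theta_less[of i j] theta_less[of j i] i j(1) by (cases i j rule: linorder_cases) auto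
    then show "x \<in> C i" using j(2) by simp
  qed (rule constant_on[OF i])
  have fin_C: "finite (C i)" if "i \<in> I" for i
    using C_eq[OF that] finite_pmf_level_set[OF theta_pos[OF that], of p] by simp
  define a where "a x = expectation (\<lambda>\<omega>. (YG x \<omega>)\<^sup>2)" for x
  have a_nonneg: "0 \<le> a x" for x unfolding a_def by simp
  have block: "(\<forall>x\<in>C i. integrable M (\<lambda>\<omega>. (YG x \<omega>)\<^sup>2)) \<and>
      (\<Sum>x\<in>C i. a x) = (\<Sum>j=1..card (C i). \<theta> i * (1 / real j - \<theta> i))" if i: "i \<in> I" for i
  proof -
    obtain r n where n: "1 \<le> n" and level: "{x. pmf p x = \<theta> i} = {r..<r + n}"
      using antimono_level_set_interval[OF dec finite_pmf_level_set[OF theta_pos[OF i]]] nonempty[OF i] C_eq[OF i]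
      by metis
    show ?thesis
      using gren_on_level_set_moment[OF refl dec level n]
      unfolding C_eq[OF i] level a_def YG by simp
  qed
  \<comment> \<open>A stretch must end in a strict descent, impossible from the value 0, so
    \<open>YG\<close> agrees with \<open>Y\<close> here, and \<open>Y\<close> has variance
    0.\<close>
  have off_support: "integrable M (\<lambda>\<omega>. (YG x \<omega>)\<^sup>2) \<and> a x = 0" if x: "pmf p x = 0" for x
  proof -
    have "x \<notin> {r..s}" if "flat_stretch (pmf p) r s" for r s
    proof
      assume "x \<in> {r..s}"
      moreover have "s \<in> {r..s}" using that by (simp add: flat_stretch_def)
      ultimately have "pmf p x = pmf p r" "pmf p s = pmf p r"
        using that unfolding flat_stretch_def by blast+
      then have "pmf p s = 0" using x by simp
      moreover have "pmf p s > pmf p (s + 1)" using that unfolding flat_stretch_def by blast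
      ultimately show False using pmf_nonneg[of p "s + 1"] by simp
    qed
    then have "YG x \<omega> = Y x \<omega>" for \<omega> unfolding YG by (intro gren_on_stretches_not_flat) auto
    then show ?thesis
      using integrable_Y_square[of x] expectation_Y_mult[of x x] x by (simp add: a_def power2_eq_square)
  qed
  have int: "integrable M (\<lambda>\<omega>. (YG x \<omega>)\<^sup>2)" for x
  proof (cases "pmf p x = 0")
    case False
    then have "x \<in> (\<Union>i\<in>I. C i)" using cover by (simp add: pmf_pos)
    then show ?thesis using block by blast
  qed (use off_support in blast)
  have sum_p: "pmf p summable_on (\<Union>i\<in>I. C i)"
    by (intro nonneg_bdd_above_summable_on bdd_aboveI[where M=1]) (auto intro: sum_pmf_le_1)
  \<comment> \<open>Bounding 1/j - \<theta> by 1 leaves exactly the probability mass of the block,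
    and the total mass makes the series of block contributions converge.\<close>
  have bound: "(\<Sum>x\<in>C i. a x) \<le> (\<Sum>x\<in>C i. pmf p x)" if i: "i \<in> I" for i
  proof -
    have "(\<Sum>x\<in>C i. a x) = (\<Sum>j=1..card (C i). \<theta> i * (1 / real j - \<theta> i))"
      using block[OF i] by blast
    also have "\<dots> \<le> (\<Sum>j=1..card (C i). \<theta> i * 1)"
    proof (intro sum_mono mult_left_mono)
      fix j assume "j \<in> {1..card (C i)}"
      then have "1 / real j \<le> 1" by simp
      then show "1 / real j - \<theta> i \<le> 1" using theta_pos[OF i] by linarith
    qed (use theta_pos[OF i] in simp)
    finally show ?thesis using constant_on[OF i] by simp
  qed
  have "(\<lambda>i. \<Sum>x\<in>C i. a x) summable_on I"
    using has_sum_imp_summable[OF has_sum_UN_finite[OF sum_p disjoint fin_C]] bound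
    by (rule summable_on_comparison_test) (auto intro: sum_nonneg a_nonneg)
  then have sum_a: "a summable_on (\<Union>i\<in>I. C i)"
    by (rule summable_on_UnionI[rotated]) (auto intro!: has_sum_finite fin_C a_nonneg disjoint)
  have a_blocks: "((\<lambda>i. \<Sum>j=1..card (C i). \<theta> i * (1 / real j - \<theta> i)) has_sum infsum a (\<Union>i\<in>I. C i)) I"
    using has_sum_UN_finite[OF sum_a disjoint fin_C] block
    by (subst has_sum_cong[where g="\<lambda>i. \<Sum>x\<in>C i. a x"]) auto
  have "(a has_sum infsum a (\<Union>i\<in>I. C i)) UNIV"
    using has_sum_infsum[OF sum_a]
  proof (rule has_sum_cong_neutral[THEN iffD1, rotated -1])
    show "a x = 0" if "x \<in> UNIV - (\<Union>i\<in>I. C i)" for x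
      using that off_support[of x] unfolding cover by (simp add: pmf_pos not_less order.antisym)
  qed auto
  then have a_sums: "a sums infsum a (\<Union>i\<in>I. C i)" by (rule has_sum_imp_sums)
  \<comment> \<open>A real \<open>suminf\<close> is informative only for summable series. Working
    first with extended values, finiteness of the mean gives almost sure summability.\<close>
  have "(\<integral>\<^sup>+\<omega>. (\<Sum>x. ennreal ((YG x \<omega>)\<^sup>2)) \<partial>M) = (\<Sum>x. ennreal (a x))"
    using int by (subst nn_integral_suminf) (auto simp: nn_integral_eq_integral a_def)
  also have "\<dots> \<noteq> \<infinity>"
    using a_sums a_nonneg by (simp add: ennreal_suminf_neq_top sums_iff)
  finally have "AE \<omega> in M. (\<Sum>x. ennreal ((YG x \<omega>)\<^sup>2)) \<noteq> \<infinity>"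
    using int by (intro nn_integral_PInf_AE) auto
  then have AE_sum: "AE \<omega> in M. summable (\<lambda>x. (YG x \<omega>)\<^sup>2)"
    by eventually_elim (auto intro: summable_suminf_not_top)
  have part1: "(AE \<omega> in M. summable (\<lambda>x. (YG x \<omega>)\<^sup>2)) \<and>
      integrable M (\<lambda>\<omega>. \<Sum>x. (YG x \<omega>)\<^sup>2) \<and>
      (\<lambda>i. \<Sum>j=1..card (C i). \<theta> i * (1 / real j - \<theta> i)) summable_on I \<and>
      (\<integral>\<omega>. (\<Sum>x. (YG x \<omega>)\<^sup>2) \<partial>M)
        = (\<Sum>\<^sub>\<infinity>i\<in>I. \<Sum>j=1..card (C i). \<theta> i * (1 / real j - \<theta> i))"
  proof (intro conjI)
    have AE_norm: "AE \<omega> in M. summable (\<lambda>x. norm ((YG x \<omega>)\<^sup>2))" using AE_sum by simp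
    have sum_norm: "summable (\<lambda>x. \<integral>\<omega>. norm ((YG x \<omega>)\<^sup>2) \<partial>M)"
      using a_sums by (simp add: a_def[abs_def] sums_iff)
    show "integrable M (\<lambda>\<omega>. \<Sum>x. (YG x \<omega>)\<^sup>2)"
      using int AE_norm sum_norm by (rule integrable_suminf)
    show "(\<lambda>i. \<Sum>j=1..card (C i). \<theta> i * (1 / real j - \<theta> i)) summable_on I"
      using a_blocks by (rule has_sum_imp_summable)
    have "(\<integral>\<omega>. (\<Sum>x. (YG x \<omega>)\<^sup>2) \<partial>M) = (\<Sum>x. a x)"
      unfolding a_def using int AE_norm sum_norm by (rule integral_suminf)
    then show "(\<integral>\<omega>. (\<Sum>x. (YG x \<omega>)\<^sup>2) \<partial>M)
        = (\<Sum>\<^sub>\<infinity>i\<in>I. \<Sum>j=1..card (C i). \<theta> i * (1 / real j - \<theta> i))"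
      using a_sums infsumI[OF a_blocks] by (simp add: sums_iff)
  qed (rule AE_sum)
  have part2: "let \<kappa> = Sup {x. pmf p x > 0} in
         integrable M (\<lambda>\<omega>. \<Sum>x=0..\<kappa>. (YG x \<omega>)\<^sup>2 / pmf p x) \<and>
         (\<lambda>i. \<Sum>j=1..card (C i). 1 / real j - \<theta> i) summable_on I \<and>
         (\<integral>\<omega>. (\<Sum>x=0..\<kappa>. (YG x \<omega>)\<^sup>2 / pmf p x) \<partial>M)
           = (\<Sum>\<^sub>\<infinity>i\<in>I. \<Sum>j=1..card (C i). 1 / real j - \<theta> i)"
    if bdd: "bdd_above {x. pmf p x > 0}"
  proof -
    define \<kappa> where "\<kappa> = Sup {x. pmf p x > 0}"
    have fin: "finite {x. pmf p x > 0}" using bdd by (simp add: bdd_above_nat)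
    have ne: "{x. pmf p x > 0} \<noteq> {}" using set_pmf_not_empty[of p] by (simp add: pmf_positive_iff)
    have \<kappa>: "\<kappa> = Max {x. pmf p x > 0}" unfolding \<kappa>_def using fin ne by (rule cSup_eq_Max)
    have "0 < pmf p x" if "x \<le> \<kappa>" for x
      using Max_in[OF fin ne] antimonoD[OF dec that] unfolding \<kappa> by simp
    then have support: "{x. pmf p x > 0} = {0..\<kappa>}"
      using Max_ge[OF fin] unfolding \<kappa>[symmetric] by auto
    \<comment> \<open>On a block the divisor is the constant \<theta>, which cancels the factor
      \<theta> of the first formula. As \<open>p\<close> decreases, the support is all of
      \<open>{0..\<kappa>}\<close>, so no divisor is zero.\<close>
    define b where "b x = a x / pmf p x" for x
    have "finite (\<Union>i\<in>I. C i)" unfolding cover by (rule fin)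
    then have "b summable_on (\<Union>i\<in>I. C i)" "infsum b (\<Union>i\<in>I. C i) = (\<Sum>x=0..\<kappa>. b x)"
      unfolding cover support by simp_all
    note b = has_sum_UN_finite[OF this(1) disjoint fin_C, unfolded this(2)]
    have "(\<Sum>x\<in>C i. b x) = (\<Sum>j=1..card (C i). 1 / real j - \<theta> i)" if i: "i \<in> I" for i
    proof -
      have "(\<Sum>x\<in>C i. b x) = (\<Sum>x\<in>C i. a x) / \<theta> i"
        unfolding sum_divide_distrib b_def using constant_on[OF i] by (intro sum.cong) auto
      then show ?thesis using block[OF i] theta_pos[OF i] by (simp add: sum_distrib_left[symmetric])
    qed
    then have b_blocks: "((\<lambda>i. \<Sum>j=1..card (C i). 1 / real j - \<theta> i) has_sum (\<Sum>x=0..\<kappa>. b x)) I"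
      using b by (subst has_sum_cong[where g="\<lambda>i. \<Sum>x\<in>C i. b x"]) auto
    have "integrable M (\<lambda>\<omega>. \<Sum>x=0..\<kappa>. (YG x \<omega>)\<^sup>2 / pmf p x)"
      using int by (intro Bochner_Integration.integrable_sum integrable_divide)
    moreover have "(\<integral>\<omega>. (\<Sum>x=0..\<kappa>. (YG x \<omega>)\<^sup>2 / pmf p x) \<partial>M) = (\<Sum>x=0..\<kappa>. b x)"
      using int by (subst Bochner_Integration.integral_sum) (auto simp: a_def b_def)
    ultimately show ?thesis
      unfolding Let_def \<kappa>_def[symmetric] using infsumI[OF b_blocks] has_sum_imp_summable[OF b_blocks] by simp
  qed
  show ?thesis using part1 part2 by blast
qed

end
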